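(* For every $n\ge1$ and every $A\in M_2(\mathbb C)^{\otimes n}$, $$\big\|A-2^{-n}\operatorname{tr}(A)\mathbf 1\big\|_1\le\pi\,\Big\|\Big(\sum_{j=1}^n d_j(A)^*d_j(A)\Big)^{1/2}\Big\|_1\le\sqrt2\,\pi\,\big\|\Gamma(A)^{1/2}\big\|_1 .$$
   Context: On $M_2(\mathbb{C})^{\otimes n}\cong M_{2^n}(\mathbb{C})$ (trace $\operatorname{tr}$, identity $\mathbf 1$), $\|A\|_1=2^{-n}\operatorname{tr}|A|$. For $1\le j\le n$, $d_j=\mathbb I^{\otimes(j-1)}\otimes(\mathbb I-\tfrac12\operatorname{tr}(\cdot)\mathbf 1)\otimes\mathbb I^{\otimes(n-j)}$, where $\mathbb I$ is the identity map on $M_2(\mathbb{C})$; $\mathcal L=\sum_{j=1}^nd_j$; and $\Gamma(A)=\frac12\big(\mathcal L(A^* )A+A^*\mathcal L(A)-\mathcal L(A^*A)\big)$ is the carré du champ operator (a positive semidefinite operator). *)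

theory Defs
  imports "HOL-Analysis.Analysis"
begin

text \<open>
  The \<open>n\<close> tensor factors are labelled by a finite type \<open>'n\<close> with \<open>n = CARD('n)\<close>; a finite type
  variable ranges over all cardinalities \<open>n \<ge> 1\<close>.  Basis vectors of \<open>(\<complex>\<^sup>2)\<^sup>\<otimes>\<^sup>n\<close> are labelled by
  functions \<open>'n \<Rightarrow> 2\<close>, of which there are \<open>2^n\<close>.
\<close>

type_synonym mat2 = "complex^2^2"
type_synonym 'n qmat = "complex^('n \<Rightarrow> 2)^('n \<Rightarrow> 2)"

definition adj :: "complex^'i^'j \<Rightarrow> complex^'j^'i" where
  "adj A = (\<chi> i j. cnj (A $ j $ i))"

text \<open>Over \<open>\<complex>\<close>, real-valuedness of the quadratic form already forces \<open>A\<close> to be Hermitian.\<close>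

definition psd :: "complex^'i::finite^'i \<Rightarrow> bool" where
  "psd A \<longleftrightarrow> (\<forall>v. (\<Sum>i\<in>UNIV. cnj (v $ i) * (A *v v) $ i) \<in> \<real>\<^sub>\<ge>\<^sub>0)"

text \<open>Meaningful for positive semidefinite arguments only.\<close>

definition mat_sqrt :: "complex^'i::finite^'i \<Rightarrow> complex^'i^'i" where
  "mat_sqrt A = (THE B. psd B \<and> B ** B = A)"

definition mat_abs :: "complex^'i::finite^'i \<Rightarrow> complex^'i^'i" where
  "mat_abs A = mat_sqrt (adj A ** A)"

text \<open>The trace of \<open>|A|\<close> is a nonnegative real, so taking its real part loses nothing.\<close>

definition norm1 :: "('n::finite) qmat \<Rightarrow> real" where
  "norm1 A = Re (trace (mat_abs A)) / 2 ^ CARD('n)"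

definition tensor_mat :: "('n::finite \<Rightarrow> mat2) \<Rightarrow> 'n qmat" where
  "tensor_mat B = (\<chi> u v. \<Prod>k\<in>UNIV. B k $ u k $ v k)"

definition mat_unit :: "2 \<Rightarrow> 2 \<Rightarrow> mat2" where
  "mat_unit a b = (\<chi> i j. if i = a \<and> j = b then 1 else 0)"

text \<open>
  The tensor product of linear maps \<open>T k\<close> on \<open>M\<^sub>2(\<complex>)\<close>: the linear map sending the matrix unit
  \<open>E(x,y)\<close>, which is the elementary tensor of the \<open>mat_unit (x k) (y k)\<close>, to the elementary tensor
  of their images.
\<close>

definition tensor_map :: "('n::finite \<Rightarrow> mat2 \<Rightarrow> mat2) \<Rightarrow> 'n qmat \<Rightarrow> 'n qmat" where
  "tensor_map T A = (\<chi> u v. \<Sum>x\<in>UNIV. \<Sum>y\<in>UNIV.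
     A $ x $ y * tensor_mat (\<lambda>k. T k (mat_unit (x k) (y k))) $ u $ v)"

lemma tensor_map_tensor_mat:
  fixes T :: "'n::finite \<Rightarrow> mat2 \<Rightarrow> mat2"
  assumes add: "\<And>k X Y. T k (X + Y) = T k X + T k Y"
    and scale: "\<And>k c X. T k (mat c ** X) = mat c ** T k X"
  shows "tensor_map T (tensor_mat B) = tensor_mat (\<lambda>k. T k (B k))"
proof -
  have sc: "(mat c ** X) $ i $ j = c * X $ i $ j" for c :: complex and X :: mat2 and i j
    by (simp add: matrix_matrix_mult_def mat_def if_distrib[of "\<lambda>t. t * _"] cong: if_cong)
  have zero: "T k 0 = 0" for k using add[of k 0 0] by simp
  have tsum: "T k (sum f S) = (\<Sum>s\<in>S. T k (f s))" if "finite S" for k S and f :: "2 \<times> 2 \<Rightarrow> mat2"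
    using that by induction (auto simp: add zero)
  have dec: "X = (\<Sum>p\<in>UNIV. mat (X $ fst p $ snd p) ** mat_unit (fst p) (snd p))" for X :: mat2
  proof -
    have "(\<Sum>p\<in>UNIV. (mat (X $ fst p $ snd p) ** mat_unit (fst p) (snd p))) $ i $ j = X $ i $ j" for i j
    proof -
      have "(\<Sum>p\<in>UNIV. (mat (X $ fst p $ snd p) ** mat_unit (fst p) (snd p))) $ i $ j
          = (\<Sum>p\<in>UNIV. if p = (i,j) then X $ i $ j else 0)"
        unfolding sum_component by (intro sum.cong refl) (auto simp: sc mat_unit_def)
      also have "\<dots> = X $ i $ j" by simp
      finally show ?thesis .
    qed
    then show ?thesis unfolding vec_eq_iff by metis
  qed
  have lin: "T k X $ a $ b = (\<Sum>p\<in>UNIV. X $ fst p $ snd p * T k (mat_unit (fst p) (snd p)) $ a $ b)" for k X a b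
    by (subst dec[of X]) (simp add: tsum scale sc)
  have "(\<Sum>x\<in>UNIV. \<Sum>y\<in>UNIV. (\<Prod>k\<in>UNIV. B k $ x k $ y k) * (\<Prod>k\<in>UNIV. T k (mat_unit (x k) (y k)) $ u k $ v k))
     = (\<Prod>k\<in>UNIV. T k (B k) $ u k $ v k)" (is "?l = _") for u v
  proof -
    define g where "g k p = B k $ fst p $ snd p * T k (mat_unit (fst p) (snd p)) $ u k $ v k" for k p
    have "?l = (\<Sum>z\<in>UNIV \<times> UNIV. \<Prod>k\<in>UNIV. g k (fst z k, snd z k))"
      by (simp add: sum.cartesian_product prod.distrib g_def case_prod_beta)
    also have "\<dots> = (\<Sum>f\<in>UNIV. \<Prod>k\<in>UNIV. g k (f k))"
      by (rule sum.reindex_bij_witness[of _ "\<lambda>f. (\<lambda>k. fst (f k), \<lambda>k. snd (f k))" "\<lambda>z k. (fst z k, snd z k)"]) auto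
    also have "\<dots> = (\<Prod>k\<in>UNIV. \<Sum>p\<in>UNIV. g k p)"
      using prod_sum_PiE[of UNIV "\<lambda>_. UNIV" g] by simp
    also have "\<dots> = (\<Prod>k\<in>UNIV. T k (B k) $ u k $ v k)"
      by (simp add: g_def lin[symmetric])
    finally show ?thesis .
  qed
  then show ?thesis by (simp add: tensor_map_def tensor_mat_def vec_eq_iff)
qed

definition dq :: "'n::finite \<Rightarrow> 'n qmat \<Rightarrow> 'n qmat" where
  "dq j = tensor_map (\<lambda>k. if k = j then (\<lambda>X. X - mat (trace X / 2)) else (\<lambda>X. X))"

definition Lop :: "('n::finite) qmat \<Rightarrow> 'n qmat" where
  "Lop A = (\<Sum>j\<in>UNIV. dq j A)"

definition carre_du_champ :: "('n::finite) qmat \<Rightarrow> 'n qmat" where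
  "carre_du_champ A = (1/2) *\<^sub>R (Lop (adj A) ** A + adj A ** Lop A - Lop (adj A ** A))"

end

theory Submission
  imports Defs
begin

text \<open>
  For a set \<open>T\<close> of tensor factors let \<open>E\<^sub>T\<close> be the conditional expectation that averages over the
  factors in \<open>T\<close>; then \<open>d\<^sub>j = 1 - E\<^sub>j\<close>.  By duality choose a contraction \<open>B\<close> pairing with
  \<open>A - 2\<^sup>-\<^sup>n tr A\<close> to its trace norm.  Let \<open>S\<close> be a random set containing each coordinate independently
  with probability \<open>r\<close>, and let \<open>\<phi>(r)\<close> be the expected pairing of \<open>E\<^bsub>-S\<^esub> B\<close> with \<open>A\<close>.  Then
  \<open>\<phi>(1) - \<phi>(0)\<close> is the trace norm to be bounded, and \<open>\<phi>'(r)\<close> is the sum over \<open>j\<close> of the pairings of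
  \<open>d\<^sub>j(A)\<close> with the covariance of \<open>E\<^bsub>-S\<^esub> B\<close> and the centred indicator of \<open>j \<in> S\<close>, divided by
  \<open>r (1 - r)\<close>.  The centred indicators are orthogonal with variance \<open>r (1 - r)\<close>, so Bessel's
  inequality and a column Hoelder inequality bound \<open>\<phi>'(r)\<close> by \<open>1 / sqrt (r (1 - r))\<close> times the trace of
  the square root of \<open>\<Sum>\<^sub>j d\<^sub>j(A)\<^sup>* d\<^sub>j(A)\<close>; the factor integrates to \<open>\<pi>\<close>.

  The second inequality holds because \<open>\<Sum>\<^sub>j d\<^sub>j(A)\<^sup>* d\<^sub>j(A) \<le> 2 \<Gamma>(A)\<close> by the Kadison-Schwarz inequality
  for each \<open>E\<^sub>j\<close>, and the trace of the square root is monotone.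

  Throughout, \<open>inner\<close> is the real part of the Hermitian inner product, and matrices act as real
  linear maps; the real trace of such a map is twice the real part of the complex trace.
\<close>

subsection \<open>Self-adjoint operators on a Euclidean space\<close>

text \<open>A maximiser \<open>e\<close> of the quadratic form on the unit sphere of
  \<open>S\<close> is an eigenvector: the first variation at \<open>e\<close> in the direction
  \<open>l *\<^sub>R e - f e\<close> forces that vector to vanish.\<close>

lemma selfadjoint_eigenvector:
  fixes f :: "'a::euclidean_space \<Rightarrow> 'a"
  assumes lin: "linear f" and sa: "\<And>x y. inner (f x) y = inner x (f y)"
    and S: "subspace S" "\<And>x. x \<in> S \<Longrightarrow> f x \<in> S" "S \<noteq> {0}"
  obtains e l where "e \<in> S" "norm e = 1" "f e = l *\<^sub>R e"
proof -
  interpret f: linear f by (rule lin)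
  let ?K = "S \<inter> sphere 0 1"
  obtain x where x: "x \<in> S" "x \<noteq> 0" using S subspace_0 by blast
  have "(1 / norm x) *\<^sub>R x \<in> ?K" using x S by (auto intro: subspace_scale)
  then have K1: "?K \<noteq> {}" by blast
  have K2: "compact ?K"
    using S(1) by (simp add: closed_subspace closed_Int_compact)
  have K3: "continuous_on ?K (\<lambda>x. inner (f x) x)"
    by (intro continuous_intros linear_continuous_on linear_conv_bounded_linear[THEN iffD1] lin)
  from continuous_attains_sup[OF K2 K1 K3] obtain e
    where e: "e \<in> ?K" and max: "\<And>y. y \<in> ?K \<Longrightarrow> inner (f y) y \<le> inner (f e) e"
    by (elim bexE) blast
  define l where "l = inner (f e) e"
  have form: "inner (f w) w \<le> l * inner w w" if "w \<in> S" for w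
  proof (cases "w = 0")
    case False
    then have "(1 / norm w) *\<^sub>R w \<in> ?K" using that S by (auto intro: subspace_scale)
    from max[OF this] False show ?thesis
      by (simp add: f.scale l_def divide_simps dot_square_norm power2_eq_square)
  qed (simp add: f.zero)
  define g where "g = l *\<^sub>R e - f e"
  have gS: "g \<in> S" using e S unfolding g_def by (auto intro: subspace_diff subspace_scale)
  define a c where "a = inner g g" and "c = l * inner g g - inner (f g) g"
  \<comment> \<open>The form \<open>l * inner w w - inner (f w) w\<close> is nonnegative on
    \<open>S\<close> and vanishes at \<open>e\<close>; along \<open>e + t *\<^sub>R g\<close> only
    the linear and quadratic terms in \<open>t\<close> remain.\<close>
  have q: "2 * t * a + t\<^sup>2 * c \<ge> 0" for t
  proof -
    have "e + t *\<^sub>R g \<in> S" using e gS S by (auto intro: subspace_add subspace_scale)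
    from form[OF this] have "0 \<le> l * inner (e + t *\<^sub>R g) (e + t *\<^sub>R g) - inner (f (e + t *\<^sub>R g)) (e + t *\<^sub>R g)"
      by simp
    also have "\<dots> = (l * inner e e - inner (f e) e) + t * (2 * (l * inner e g - inner (f e) g)) + t\<^sup>2 * c"
      using sa[of g e]
      by (simp add: f.add f.scale inner_add_left inner_add_right inner_commute c_def algebra_simps power2_eq_square)
    also have "l * inner e e - inner (f e) e = 0" using e by (simp add: l_def dot_square_norm)
    also have "l * inner e g - inner (f e) g = a"
      unfolding a_def by (subst (3) g_def) (simp add: inner_diff_left)
    finally show ?thesis by (simp add: algebra_simps)
  qed
  have "g = 0"
  proof (rule ccontr)
    assume "g \<noteq> 0"
    then have a: "a > 0" by (simp add: a_def)
    \<comment> \<open>\<open>k\<close> is positive and exceeds \<open>c\<close>, so at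
      \<open>t = - a / k\<close> the linear term outweighs the quadratic one and the sum is
      negative.\<close>
    define k where "k = \<bar>c\<bar> + 1"
    have k: "k > 0" "c < k" by (auto simp: k_def)
    have "2 * (- a / k) * a + (- a / k)\<^sup>2 * c = (a\<^sup>2 / k\<^sup>2) * (c - 2 * k)"
      using k by (simp add: field_simps power2_eq_square)
    also have "\<dots> < 0" using a k by (intro mult_pos_neg) auto
    finally show False using q[of "- a / k"] by simp
  qed
  then show ?thesis using that[of e l] e by (simp add: g_def)
qed

text \<open>Bases are real. On \<open>complex^'i\<close> the real dimension is twice the complex
  one, which is the source of the factors 1/2 in the trace formulas.\<close>

definition onb :: "'a::euclidean_space set \<Rightarrow> bool" where
  "onb E \<longleftrightarrow> pairwise orthogonal E \<and> (\<forall>e\<in>E. norm e = 1) \<and> span E = UNIV"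

lemma onb_finite: "onb E \<Longrightarrow> finite E"
  unfolding onb_def
  by (metis finiteI_independent norm_zero pairwise_orthogonal_independent zero_neq_one)

lemma onb_expand: "onb E \<Longrightarrow> (\<Sum>e\<in>E. inner e x *\<^sub>R e) = x"
  using orthonormal_basis_expand[of E x] onb_finite[of E] by (simp add: onb_def inner_commute)

lemma onb_inner: "onb E \<Longrightarrow> e \<in> E \<Longrightarrow> e' \<in> E \<Longrightarrow> inner e e' = (if e = e' then 1 else 0)"
  unfolding onb_def pairwise_def orthogonal_def by (auto simp: dot_square_norm)

lemma onb_parseval:
  assumes "onb E"
  shows "inner x y = (\<Sum>e\<in>E. inner e x * inner e y)"
  by (subst onb_expand[OF assms, of x, symmetric]) (simp add: inner_sum_left)

text \<open>An orthonormal set of eigenvectors of largest cardinality must span: otherwise its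
  orthogonal complement is a nonzero invariant subspace and contributes one more
  eigenvector.\<close>

theorem selfadjoint_eigenbasis:
  fixes f :: "'a::euclidean_space \<Rightarrow> 'a"
  assumes lin: "linear f" and sa: "\<And>x y. inner (f x) y = inner x (f y)"
  obtains E l where "onb E" "\<forall>e\<in>E. f e = l e *\<^sub>R e"
proof -
  interpret f: linear f by (rule lin)
  define P where "P E \<longleftrightarrow> pairwise orthogonal E \<and> (\<forall>e\<in>E. norm e = 1 \<and> (\<exists>l. f e = l *\<^sub>R e))" for E
  have bound: "finite E \<and> card E \<le> DIM('a)" if "P E" for E
  proof -
    have "0 \<notin> E" using that by (force simp: P_def)
    then have "independent E" using that by (intro pairwise_orthogonal_independent) (auto simp: P_def)
    then show ?thesis by (rule independent_bound)
  qed
  have "P {}" by (simp add: P_def pairwise_def)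
  then obtain E where E: "P E" and max: "\<And>F. P F \<Longrightarrow> card F \<le> card E"
    using ex_has_greatest_nat[of P "{}" card "Suc DIM('a)"] bound by (metis le_imp_less_Suc)
  have "span E = UNIV"
  proof (rule ccontr)
    assume ne: "span E \<noteq> UNIV"
    let ?S = "{y. \<forall>e\<in>E. inner y e = 0}"
    have "span E \<subset> span UNIV" using ne by (simp add: psubset_eq)
    from orthogonal_to_subspace_exists_gen[OF this] obtain x
      where x: "x \<noteq> 0" "\<And>y. y \<in> span E \<Longrightarrow> orthogonal x y" by blast
    have S1: "subspace ?S" by (auto simp: subspace_def inner_add_left)
    have S2: "f y \<in> ?S" if "y \<in> ?S" for y
      using that E by (auto simp: sa P_def)
    have "x \<in> ?S" using x(2) by (auto simp: orthogonal_def span_base)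
    then have S3: "?S \<noteq> {0}" using x(1) by blast
    obtain e l where e: "e \<in> ?S" "norm e = 1" "f e = l *\<^sub>R e"
      by (rule selfadjoint_eigenvector[OF lin sa S1 S2 S3])
    have "e \<notin> E" using e by (auto simp: dot_square_norm)
    moreover have "P (insert e E)"
      using E e by (auto simp: P_def pairwise_insert orthogonal_def inner_commute)
    ultimately show False using max[of "insert e E"] bound[OF E] by auto
  qed
  then have "onb E" using E by (auto simp: onb_def P_def)
  moreover have "\<forall>e\<in>E. \<exists>l. f e = l *\<^sub>R e" using E by (auto simp: P_def)
  then obtain l where "\<forall>e\<in>E. f e = l e *\<^sub>R e" by metis
  ultimately show ?thesis using that by blast
qed

text \<open>Expanding each \<open>f e\<close> in \<open>F\<close> and resumming over
  \<open>E\<close> turns one sum into the other.\<close>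

lemma onb_trace:
  fixes f :: "'a::euclidean_space \<Rightarrow> 'a"
  assumes lin: "linear f" and "onb E" "onb F"
  shows "(\<Sum>e\<in>E. inner e (f e)) = (\<Sum>e\<in>F. inner e (f e))"
proof -
  interpret f: linear f by (rule lin)
  have "(\<Sum>e\<in>E. inner e (f e)) = (\<Sum>e\<in>E. \<Sum>b\<in>F. inner b e * inner b (f e))"
    by (simp add: onb_parseval[OF assms(3), symmetric])
  also have "\<dots> = (\<Sum>b\<in>F. inner b (f (\<Sum>e\<in>E. inner e b *\<^sub>R e)))"
    by (subst sum.swap) (simp add: f.sum f.scale inner_sum_right inner_commute)
  also have "\<dots> = (\<Sum>b\<in>F. inner b (f b))" by (simp add: onb_expand[OF assms(2)])
  finally show ?thesis .
qed

lemma onb_Basis: "onb Basis"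
  by (auto simp: onb_def pairwise_def orthogonal_def inner_Basis)

subsection \<open>Complex matrices and the real inner product\<close>

lemma inner_mult_cnj: "inner (a * b) c = inner b (cnj a * (c::complex))"
  by (simp add: inner_complex_def algebra_simps)

lemma inner_adj: "inner (A *v x) y = inner x (adj A *v y)" for A :: "complex^'i::finite^'j::finite"
proof -
  have "inner (A *v x) y = (\<Sum>i\<in>UNIV. \<Sum>j\<in>UNIV. inner (x $ j) (cnj (A $ i $ j) * y $ i))"
    by (simp add: inner_vec_def matrix_vector_mult_def inner_sum_left inner_mult_cnj)
  also have "\<dots> = (\<Sum>j\<in>UNIV. \<Sum>i\<in>UNIV. inner (x $ j) (cnj (A $ i $ j) * y $ i))"
    by (rule sum.swap)
  also have "\<dots> = inner x (adj A *v y)"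
    by (simp add: inner_vec_def matrix_vector_mult_def inner_sum_right adj_def)
  finally show ?thesis .
qed

lemma adj_adj [simp]: "adj (adj A) = A"
  by (simp add: adj_def vec_eq_iff)

lemma inner_adj': "inner x (A *v y) = inner (adj A *v x) y" for A :: "complex^'i::finite^'j::finite"
  using inner_adj[of "adj A" x y] by simp

lemma adj_mult: "adj (A ** B) = adj B ** adj A"
  by (simp add: adj_def vec_eq_iff matrix_matrix_mult_def mult.commute)

lemma adj_add: "adj (A + B) = adj A + adj B"
  and adj_diff: "adj (A - B) = adj A - adj B"
  and adj_scaleR: "adj (r *\<^sub>R A) = r *\<^sub>R adj A"
  and adj_0: "adj 0 = 0"
  by (simp_all add: adj_def vec_eq_iff)

lemma adj_sum: "adj (\<Sum>i\<in>I. f i) = (\<Sum>i\<in>I. adj (f i))"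
  by (induction I rule: infinite_finite_induct) (simp_all add: adj_0 adj_add)

lemma adj_eqI:
  fixes A :: "complex^'i::finite^'i"
  assumes "\<And>x y. inner (A *v x) y = inner x (A *v y)"
  shows "adj A = A"
  unfolding matrix_eq
proof
  fix y
  have "inner x (adj A *v y) = inner x (A *v y)" for x
    using assms[of x y] inner_adj[of A x y] by simp
  then show "adj A *v y = A *v y" using vector_eq_ldot by blast
qed

lemma matrix_vector_scaleR: "A *v (r *\<^sub>R x) = r *\<^sub>R (A *v x)" for A :: "complex^'i::finite^'j::finite"
  by (rule linear_scale[OF matrix_vector_mul_linear])

lemma scaleR_matrix_vector: "(r *\<^sub>R A) *v x = r *\<^sub>R (A *v x)" for A :: "complex^'i::finite^'j::finite"
  by (simp add: matrix_vector_mult_def vec_eq_iff scaleR_sum_right)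

lemma sum_matrix_vector_mult: "(\<Sum>i\<in>I. f i) *v x = (\<Sum>i\<in>I. f i *v x)"
  by (induction I rule: infinite_finite_induct) (simp_all add: matrix_vector_mult_add_rdistrib)

lemma cnj_mult_inner: "cnj a * b = Complex (inner a b) (inner (\<i> * a) b)"
  by (simp add: complex_eq_iff inner_complex_def)

text \<open>Bridge from the complex form in \<open>psd\<close> to the real inner product: the
  imaginary part is the pairing with \<open>\<i> *s v\<close>.\<close>

lemma form_inner:
  "(\<Sum>i\<in>UNIV. cnj (v $ i) * w $ i) = Complex (inner v w) (inner (\<i> *s v) w)"
  for v w :: "complex^'i::finite"
  by (simp add: cnj_mult_inner inner_vec_def complex_eq_iff)

text \<open>Polarising the vanishing imaginary part at \<open>x + \<i> *s y\<close> gives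
  self-adjointness. Conversely, multiplication by \<open>\<i>\<close> is skew and commutes with
  \<open>A\<close>, so a Hermitian \<open>A\<close> has a form without imaginary part.\<close>

lemma psd_iff:
  fixes A :: "complex^'i::finite^'i"
  shows "psd A \<longleftrightarrow> adj A = A \<and> (\<forall>v. 0 \<le> inner v (A *v v))"
proof
  assume "psd A"
  then have re: "0 \<le> inner v (A *v v)" and im: "inner (\<i> *s v) (A *v v) = 0" for v
    unfolding psd_def form_inner by (simp_all add: complex_nonneg_Reals_iff)
  have "inner (A *v x) y = inner x (A *v y)" for x y
  proof -
    let ?y = "\<i> *s y"
    have J: "\<i> *s (\<i> *s y) = - y" by (simp add: vec_eq_iff)
    have JJ: "inner (\<i> *s v) (\<i> *s w) = inner v w" for v w :: "complex^'i"
      by (simp add: inner_vec_def inner_complex_def algebra_simps)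
    have "inner (\<i> *s (x + ?y)) (A *v (x + ?y)) = 0" by (rule im)
    then have "inner (\<i> *s x) (A *v ?y) + inner (\<i> *s ?y) (A *v x) = 0"
      using im[of x] im[of ?y]
      by (simp add: vector_add_ldistrib matrix_vector_right_distrib inner_add_left inner_diff_left inner_add_right)
    moreover have "A *v ?y = \<i> *s (A *v y)" by (simp add: vec.scale)
    ultimately show ?thesis by (simp add: J JJ inner_commute)
  qed
  then show "adj A = A \<and> (\<forall>v. 0 \<le> inner v (A *v v))" using re adj_eqI by blast
next
  assume A: "adj A = A \<and> (\<forall>v. 0 \<le> inner v (A *v v))"
  have "inner (\<i> *s v) (A *v v) = 0" for v
  proof -
    have "inner (\<i> *s v) (A *v v) = inner (\<i> *s (A *v v)) v"
      using A inner_adj'[of "\<i> *s v" A v] by (simp add: vec.scale)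
    also have "\<dots> = - inner (A *v v) (\<i> *s v)"
      by (simp add: inner_vec_def inner_complex_def sum_negf[symmetric] algebra_simps)
    finally show ?thesis by (simp add: inner_commute)
  qed
  then show "psd A" unfolding psd_def form_inner using A by (simp add: complex_nonneg_Reals_iff)
qed

section \<open>Spectral theorem and functional calculus for Hermitian matrices\<close>

lemma hermitian_inner: "adj A = A \<Longrightarrow> inner (A *v x) y = inner x (A *v y)"
  for A :: "complex^'i::finite^'i"
  using inner_adj[of A x y] by simp

lemma hermitian_eigenbasis:
  fixes A :: "complex^'i::finite^'i"
  assumes "adj A = A"
  obtains E l where "onb E" "\<forall>e\<in>E. A *v e = l e *\<^sub>R e"
proof -
  have "linear ((*v) A)" by simp
  then show thesis
  proof (rule selfadjoint_eigenbasis)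
    show "inner (A *v x) y = inner x (A *v y)" for x y by (rule hermitian_inner[OF assms])
  next
    fix E l assume "onb E" "\<forall>e\<in>E. A *v e = l e *\<^sub>R e"
    then show thesis by (rule that)
  qed
qed

text \<open>By basis independence the standard real basis may be used; there each diagonal entry is
  counted twice, once for 1 and once for \<open>\<i>\<close>.\<close>

lemma Re_trace_onb:
  fixes A :: "complex^'i::finite^'i"
  assumes "onb E"
  shows "Re (trace A) = (\<Sum>e\<in>E. inner e (A *v e)) / 2"
proof -
  have ax: "inner (axis i c) (A *v axis i c) = (cmod c)\<^sup>2 * Re (A $ i $ i)" for i c
  proof -
    have "(A *v axis i c) $ i = A $ i $ i * c"
      by (simp add: matrix_vector_mult_def axis_def if_distrib cong: if_cong)
    then show ?thesis
      by (simp add: inner_axis' inner_complex_def cmod_power2) (simp add: algebra_simps power2_eq_square)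
  qed
  let ?a = "\<lambda>p. axis (fst p) (snd p) :: complex^'i"
  have "(Basis :: (complex^'i) set) = ?a ` (UNIV \<times> Basis)"
    by (auto simp: Basis_vec_def image_iff) blast+
  then have "(\<Sum>b\<in>Basis. inner b (A *v b)) = (\<Sum>b\<in>?a ` (UNIV \<times> Basis). inner b (A *v b))"
    by simp
  also have "\<dots> = (\<Sum>p\<in>UNIV \<times> Basis. inner (?a p) (A *v ?a p))"
    by (rule sum.reindex_cong[OF _ refl refl]) (auto simp: inj_on_def axis_eq_axis)
  also have "\<dots> = 2 * Re (trace A)"
    unfolding sum.cartesian_product' by (simp add: ax trace_def Basis_complex_def sum_distrib_left)
  finally show ?thesis using onb_trace[OF matrix_vector_mul_linear assms onb_Basis, of A] by simp
qed

lemma inner_matrix: "inner X Y = Re (trace (adj X ** Y))"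
  for X Y :: "complex^'i::finite^'j::finite"
proof -
  have "inner X Y = (\<Sum>i\<in>UNIV. \<Sum>j\<in>UNIV. Re (cnj (X $ j $ i) * Y $ j $ i))"
    by (subst sum.swap) (simp add: inner_vec_def inner_complex_def)
  then show ?thesis by (simp add: trace_def matrix_matrix_mult_def adj_def)
qed

lemma inner_matrix_onb:
  fixes X Y :: "complex^'i::finite^'j::finite"
  assumes "onb E"
  shows "inner X Y = (\<Sum>e\<in>E. inner (X *v e) (Y *v e)) / 2"
  by (simp add: inner_matrix Re_trace_onb[OF assms] inner_adj matrix_vector_mul_assoc)

text \<open>\<open>M\<close> is \<open>f\<close> applied to \<open>A\<close>. It is specified on all
  eigenvectors, so that it can be evaluated in any eigenbasis chosen later.\<close>

lemma hermitian_calculus: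
  fixes A :: "complex^'i::finite^'i" and f :: "real \<Rightarrow> real"
  assumes A: "adj A = A"
  obtains M where "adj M = M" "\<And>l v. A *v v = l *\<^sub>R v \<Longrightarrow> M *v v = f l *\<^sub>R v"
proof -
  obtain E l where E: "onb E" and Ee: "\<forall>e\<in>E. A *v e = l e *\<^sub>R e"
    by (rule hermitian_eigenbasis[OF A])
  define S where "S v = (\<Sum>e\<in>E. (f (l e) * inner e v) *\<^sub>R e)" for v
  have eig: "S v = f m *\<^sub>R v" if "A *v v = m *\<^sub>R v" for m v
  proof -
    \<comment> \<open>Eigenvectors for distinct eigenvalues are orthogonal, so only basis vectors
      with \<open>l e = m\<close> contribute.\<close>
    have "f (l e) * inner e v = f m * inner e v" if "e \<in> E" for e
    proof (cases "l e = m")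
      case False
      have "l e * inner e v = m * inner e v"
        using hermitian_inner[OF A, of e v] by (simp add: Ee that \<open>A *v v = m *\<^sub>R v\<close>)
      then show ?thesis using False by simp
    qed simp
    then have "S v = f m *\<^sub>R (\<Sum>e\<in>E. inner e v *\<^sub>R e)"
      by (auto simp: S_def scaleR_sum_right intro!: sum.cong)
    then show ?thesis by (simp add: onb_expand[OF E])
  qed
  have add: "S (v + w) = S v + S w" for v w
    by (simp add: S_def inner_add_right scaleR_add_left distrib_left sum.distrib)
  have scale: "S (c *\<^sub>R v) = c *\<^sub>R S v" for c v
    by (simp add: S_def scaleR_sum_right mult.left_commute)
  have linS: "linear S" using add scale by (rule linearI)
  have linJ: "linear (\<lambda>v::complex^'i. \<i> *s v)"
    by (rule linearI) (simp_all add: vec_eq_iff scaleR_conv_of_real algebra_simps)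
  \<comment> \<open>\<open>S\<close> is built from a real basis, so complex linearity needs an
    argument: \<open>\<i> *s e\<close> is an eigenvector of \<open>A\<close> with the same
    eigenvalue as \<open>e\<close>.\<close>
  have SJ: "S (\<i> *s v) = \<i> *s S v" for v
  proof (rule linear_eq_on_span[of "\<lambda>v. S (\<i> *s v)" "\<lambda>v. \<i> *s S v" E])
    show "linear (\<lambda>v. S (\<i> *s v))" using linear_compose[OF linJ linS] by (simp add: o_def)
    show "linear (\<lambda>v. \<i> *s S v)" using linear_compose[OF linS linJ] by (simp add: o_def)
    show "v \<in> span E" using E by (simp add: onb_def)
    fix e assume e: "e \<in> E"
    have "A *v (\<i> *s e) = l e *\<^sub>R (\<i> *s e)"
      by (simp add: vec.scale Ee e) (simp add: vec_eq_iff)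
    from eig[OF this] eig[OF Ee[rule_format, OF e]] show "S (\<i> *s e) = \<i> *s S e"
      by (simp add: vec_eq_iff)
  qed
  have cs: "c *s v = Re c *\<^sub>R v + Im c *\<^sub>R (\<i> *s v)" for c :: complex and v :: "complex^'i"
    by (simp add: vec_eq_iff complex_eq_iff)
  have "S (c *s v) = c *s S v" for c v
    unfolding cs[of c] add scale SJ ..
  then have "Vector_Spaces.linear (*s) (*s) S"
    using add by (simp add: Vector_Spaces.linear_iff vec.vector_space_axioms)
  then have M: "matrix S *v v = S v" for v by (rule matrix_works)
  have "adj (matrix S) = matrix S"
  proof (rule adj_eqI)
    show "inner (matrix S *v x) y = inner x (matrix S *v y)" for x y
      by (simp add: M S_def inner_sum_left inner_sum_right inner_commute mult_ac)
  qed
  with that show ?thesis using eig M by metis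
qed

subsection \<open>Square roots and the trace norm\<close>

lemma matrix_eq_onb:
  fixes A B :: "complex^'i::finite^'j::finite"
  assumes "onb E" "\<And>e. e \<in> E \<Longrightarrow> A *v e = B *v e"
  shows "A = B"
  unfolding matrix_eq
proof
  show "A *v x = B *v x" for x
    by (rule linear_eq_on_span[of "(*v) A" "(*v) B" E]) (use assms in \<open>auto simp: onb_def\<close>)
qed

lemma psd_eigenvalue_nonneg:
  assumes "psd A" "A *v v = l *\<^sub>R v" "v \<noteq> 0"
  shows "0 \<le> l"
proof -
  have "0 \<le> l * inner v v" using assms(1)[unfolded psd_iff] assms(2) by (metis inner_scaleR_right)
  moreover have "0 < inner v v" using assms(3) by simp
  ultimately show ?thesis by (simp add: zero_le_mult_iff)
qed

lemma onb_nonzero: "onb E \<Longrightarrow> e \<in> E \<Longrightarrow> e \<noteq> 0"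
  by (auto simp: onb_def)

lemma psd_gram: "psd (adj X ** X)" for X :: "complex^'i::finite^'j::finite"
  by (simp add: psd_iff adj_mult inner_adj'[of _ "adj X"] matrix_vector_mul_assoc[symmetric])

lemma psd_sum: "(\<And>j. j \<in> J \<Longrightarrow> psd (f j)) \<Longrightarrow> psd (\<Sum>j\<in>J. f j)"
  by (simp add: psd_iff adj_sum sum_matrix_vector_mult inner_sum_right sum_nonneg)

lemma hermitian_square_norm:
  assumes "adj M = M"
  shows "inner v ((M ** M) *v v) = (norm (M *v v))\<^sup>2"
  by (simp add: matrix_vector_mul_assoc[symmetric] hermitian_inner[OF assms, symmetric] power2_norm_eq_inner)

text \<open>For positive \<open>l\<close>, the defect \<open>w = B *v v - sqrt l *\<^sub>R v\<close>
  satisfies \<open>B *v w = - (sqrt l *\<^sub>R w)\<close>, and a positive semidefinite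
  \<open>B\<close> has no negative eigenvalue. This yields uniqueness of the square root.\<close>

lemma psd_sqrt_eigenvector:
  assumes B: "psd B" and v: "(B ** B) *v v = l *\<^sub>R v" and l: "0 \<le> l"
  shows "B *v v = sqrt l *\<^sub>R v"
proof (cases "l = 0")
  case True
  then show ?thesis using hermitian_square_norm[of B v] B v by (simp add: psd_iff)
next
  case False
  define w where "w = B *v v - sqrt l *\<^sub>R v"
  have "sqrt l * sqrt l = l" using l by simp
  then have "B *v w = - (sqrt l *\<^sub>R w)"
    using v l by (simp add: w_def matrix_vector_mult_diff_distrib matrix_vector_mul_assoc
        matrix_vector_scaleR scaleR_diff_right)
  then have "0 \<le> - (sqrt l * inner w w)" using B[unfolded psd_iff] by (metis inner_minus_right inner_scaleR_right)
  moreover have "sqrt l > 0" using l False by simp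
  ultimately have "inner w w \<le> 0" by (simp add: mult_le_0_iff)
  then have "w = 0" by (metis inner_eq_zero_iff inner_ge_zero order_antisym)
  then show ?thesis by (simp add: w_def)
qed

text \<open>Existence comes from the functional calculus; uniqueness holds because every positive
  root acts as \<open>sqrt (l e)\<close> on the eigenvector \<open>e\<close>. The definite
  description in \<open>mat_sqrt\<close> requires both.\<close>

lemma mat_sqrt:
  assumes A: "psd A"
  shows psd_mat_sqrt: "psd (mat_sqrt A)" and mat_sqrt_square: "mat_sqrt A ** mat_sqrt A = A"
proof -
  have adjA: "adj A = A" using A by (simp add: psd_iff)
  obtain E l where E: "onb E" and Ee: "\<forall>e\<in>E. A *v e = l e *\<^sub>R e"
    by (rule hermitian_eigenbasis[OF adjA])
  have l: "0 \<le> l e" if "e \<in> E" for e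
    using psd_eigenvalue_nonneg[OF A] onb_nonzero[OF E] Ee that by blast
  obtain M where adjM: "adj M = M" and M: "\<And>l v. A *v v = l *\<^sub>R v \<Longrightarrow> M *v v = sqrt l *\<^sub>R v"
    by (rule hermitian_calculus[OF adjA, of sqrt]) blast
  have Me: "M *v e = sqrt (l e) *\<^sub>R e" if "e \<in> E" for e
    using M Ee that by blast
  have "0 \<le> inner v (M *v v)" for v
  proof -
    have "inner e v * inner e (M *v v) = sqrt (l e) * (inner e v)\<^sup>2" if "e \<in> E" for e
      using hermitian_inner[OF adjM, of e v, symmetric] Me[OF that] by (simp add: power2_eq_square)
    then show ?thesis using l by (subst onb_parseval[OF E]) (simp add: sum_nonneg)
  qed
  then have "psd M" using adjM by (simp add: psd_iff)
  moreover have "M ** M = A"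
    using Ee l by (intro matrix_eq_onb[OF E])
      (simp add: matrix_vector_mul_assoc[symmetric] matrix_vector_scaleR Me)
  moreover have "B = M" if "psd B \<and> B ** B = A" for B
  proof (rule matrix_eq_onb[OF E])
    fix e assume e: "e \<in> E"
    have "B *v e = sqrt (l e) *\<^sub>R e"
      using that Ee l e by (intro psd_sqrt_eigenvector) auto
    then show "B *v e = M *v e" by (simp add: Me e)
  qed
  ultimately have "\<exists>!B. psd B \<and> B ** B = A" by blast
  then have "psd (mat_sqrt A) \<and> mat_sqrt A ** mat_sqrt A = A"
    unfolding mat_sqrt_def by (rule theI')
  then show "psd (mat_sqrt A)" "mat_sqrt A ** mat_sqrt A = A" by auto
qed

text \<open>The hypothesis is the operator inequality between the squares of \<open>M\<close> and
  \<open>N\<close>. A positive eigenvalue of \<open>M - N\<close> at \<open>e\<close> would give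
  \<open>inner e (M *v e) + inner e (N *v e) \<le> 0\<close>, hence both forms would vanish at
  \<open>e\<close>, a contradiction. So \<open>M - N\<close> has trace at most 0.\<close>

lemma Re_trace_mono:
  fixes M N :: "complex^'i::finite^'i"
  assumes M: "psd M" and N: "psd N" and le: "\<And>v. norm (M *v v) \<le> norm (N *v v)"
  shows "Re (trace M) \<le> Re (trace N)"
proof -
  have "adj (M - N) = M - N" using M N by (simp add: psd_iff adj_diff)
  then obtain E l where E: "onb E" and Ee: "\<forall>e\<in>E. (M - N) *v e = l e *\<^sub>R e"
    by (rule hermitian_eigenbasis)
  have "inner e ((M - N) *v e) \<le> 0" if e: "e \<in> E" for e
  proof (rule ccontr)
    assume neg: "\<not> inner e ((M - N) *v e) \<le> 0"
    have D: "M *v e - N *v e = l e *\<^sub>R e"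
      using Ee e by (simp add: matrix_vector_mult_diff_rdistrib)
    have l: "l e > 0" using neg Ee e onb_inner[OF E e e] by simp
    have "(norm (M *v e))\<^sup>2 - (norm (N *v e))\<^sup>2 = inner (M *v e - N *v e) (M *v e + N *v e)"
      by (simp add: power2_norm_eq_inner inner_diff_left inner_add_right inner_commute[of "N *v e" "M *v e"])
    also have "\<dots> = l e * (inner e (M *v e) + inner e (N *v e))" by (simp add: D inner_add_right distrib_left)
    finally have "l e * (inner e (M *v e) + inner e (N *v e)) \<le> 0"
      using power_mono[OF le[of e] norm_ge_zero, of 2] by linarith
    then have "inner e (M *v e) + inner e (N *v e) \<le> 0" using l by (simp add: mult_le_0_iff)
    moreover have "0 \<le> inner e (M *v e)" "0 \<le> inner e (N *v e)" using M N by (auto simp: psd_iff)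
    ultimately show False
      using neg by (simp add: matrix_vector_mult_diff_rdistrib inner_diff_right)
  qed
  then have "Re (trace (M - N)) \<le> 0" unfolding Re_trace_onb[OF E] by (simp add: sum_nonpos)
  then show ?thesis by (simp add: trace_sub)
qed

text \<open>The traces are evaluated in an eigenbasis of \<open>M\<close>. For each
  \<open>e\<close>, Cauchy-Schwarz over \<open>j\<close> bounds the pairing by \<open>h\<close>
  times the length of the column \<open>D j *v e\<close>, which is
  \<open>norm (M *v e) = inner e (M *v e)\<close>.\<close>

lemma column_Hoelder:
  fixes D G :: "'k \<Rightarrow> complex^'i::finite^'i"
  assumes M: "psd M" and MM: "M ** M = (\<Sum>j\<in>J. adj (D j) ** D j)"
    and G: "\<And>v. (\<Sum>j\<in>J. (norm (G j *v v))\<^sup>2) \<le> h\<^sup>2 * (norm v)\<^sup>2" and h: "0 \<le> h"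
  shows "(\<Sum>j\<in>J. inner (G j) (D j)) \<le> h * Re (trace M)"
proof -
  have adjM: "adj M = M" using M by (simp add: psd_iff)
  obtain E l where E: "onb E" and Ee: "\<forall>e\<in>E. M *v e = l e *\<^sub>R e"
    by (rule hermitian_eigenbasis[OF adjM])
  have "(\<Sum>j\<in>J. inner (G j *v e) (D j *v e)) \<le> h * inner e (M *v e)" if e: "e \<in> E" for e
  proof -
    have l: "0 \<le> l e" using psd_eigenvalue_nonneg[OF M] onb_nonzero[OF E] Ee e by blast
    have ne: "norm e = 1" using E e by (simp add: onb_def)
    have "(\<Sum>j\<in>J. inner (G j *v e) (D j *v e)) \<le> (\<Sum>j\<in>J. \<bar>norm (G j *v e)\<bar> * \<bar>norm (D j *v e)\<bar>)"
      by (intro sum_mono) (simp add: norm_cauchy_schwarz)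
    also have "\<dots> \<le> L2_set (\<lambda>j. norm (G j *v e)) J * L2_set (\<lambda>j. norm (D j *v e)) J"
      by (rule L2_set_mult_ineq)
    also have "L2_set (\<lambda>j. norm (G j *v e)) J \<le> h"
      unfolding L2_set_def using G[of e] h ne by (intro real_le_lsqrt) (auto intro: sum_nonneg)
    also have "(\<Sum>j\<in>J. (norm (D j *v e))\<^sup>2) = inner e ((M ** M) *v e)"
      by (simp add: MM sum_matrix_vector_mult inner_sum_right matrix_vector_mul_assoc[symmetric]
          inner_adj' power2_norm_eq_inner)
    then have "L2_set (\<lambda>j. norm (D j *v e)) J = norm (M *v e)"
      by (simp add: L2_set_def hermitian_square_norm[OF adjM])
    also have "\<dots> = inner e (M *v e)" using Ee e l ne by (simp add: dot_square_norm)
    finally show ?thesis by (simp add: mult_right_mono)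
  qed
  then have "(\<Sum>e\<in>E. \<Sum>j\<in>J. inner (G j *v e) (D j *v e)) \<le> h * (\<Sum>e\<in>E. inner e (M *v e))"
    unfolding sum_distrib_left by (rule sum_mono)
  then show ?thesis
    by (subst (asm) sum.swap) (simp add: inner_matrix_onb[OF E] Re_trace_onb[OF E] sum_divide_distrib[symmetric])
qed

text \<open>\<open>B\<close> is the partial isometry in the polar decomposition of
  \<open>X\<close>.\<close>

lemma trace_norm_dual:
  fixes X :: "complex^'i::finite^'i"
  obtains B :: "complex^'i^'i" where "\<And>v. norm (B *v v) \<le> norm v" "inner B X = Re (trace (mat_abs X))"
proof -
  define H where "H = adj X ** X"
  have H: "psd H" unfolding H_def by (rule psd_gram)
  then have adjH: "adj H = H" by (simp add: psd_iff)
  obtain E l where E: "onb E" and Ee: "\<forall>e\<in>E. H *v e = l e *\<^sub>R e"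
    by (rule hermitian_eigenbasis[OF adjH])
  have l: "0 \<le> l e" if "e \<in> E" for e
    using psd_eigenvalue_nonneg[OF H] onb_nonzero[OF E] Ee that by blast
  \<comment> \<open>Since \<open>inverse 0 = 0\<close>, \<open>P\<close> is the pseudo-inverse of
    \<open>mat_abs X\<close>, and \<open>X ** P\<close> vanishes on the kernel of
    \<open>X\<close>.\<close>
  obtain P where adjP: "adj P = P"
    and P: "\<And>l v. H *v v = l *\<^sub>R v \<Longrightarrow> P *v v = inverse (sqrt l) *\<^sub>R v"
    by (rule hermitian_calculus[OF adjH, of "\<lambda>x. inverse (sqrt x)"]) blast
  have "norm ((X ** P) *v v) \<le> norm v" for v
  proof -
    have *: "inner e (P *v v) * inner e (H *v (P *v v)) \<le> inner e v * inner e v" if e: "e \<in> E" for e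
    proof -
      have "inner e (P *v v) = inverse (sqrt (l e)) * inner e v" for v
        using hermitian_inner[OF adjP, of e v, symmetric] P[OF Ee[rule_format, OF e]] by simp
      moreover have "inner e (H *v v) = l e * inner e v" for v
        using hermitian_inner[OF adjH, of e v, symmetric] Ee e by simp
      ultimately have "inner e (P *v v) * inner e (H *v (P *v v))
          = ((inverse (sqrt (l e)))\<^sup>2 * l e) * (inner e v * inner e v)"
        by (simp add: power2_eq_square)
      also have "(inverse (sqrt (l e)))\<^sup>2 * l e \<le> 1"
        using l[OF e] by (cases "l e = 0") (simp_all add: power_inverse)
      finally show ?thesis by (simp add: mult_right_mono)
    qed
    have "(norm ((X ** P) *v v))\<^sup>2 = inner (P *v v) (H *v (P *v v))"
      by (simp add: H_def matrix_vector_mul_assoc[symmetric] inner_adj' power2_norm_eq_inner)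
    also have "\<dots> \<le> (norm v)\<^sup>2"
      unfolding power2_norm_eq_inner onb_parseval[OF E, of "P *v v"] onb_parseval[OF E, of v v]
      by (rule sum_mono) (rule *)
    finally show ?thesis by (rule power2_le_imp_le) simp
  qed
  moreover have "inner (X ** P) X = Re (trace (mat_abs X))"
  proof -
    have "inner (X ** P) X = Re (trace (P ** H))"
      by (simp add: inner_matrix adj_mult adjP H_def matrix_mul_assoc)
    also have "\<dots> = Re (trace (mat_abs X))"
    proof -
      have "(P ** H) *v e = mat_abs X *v e" if e: "e \<in> E" for e
      proof -
        have "mat_abs X *v e = sqrt (l e) *\<^sub>R e"
          unfolding mat_abs_def H_def[symmetric]
          using Ee e l by (intro psd_sqrt_eigenvector) (simp_all add: psd_mat_sqrt[OF H] mat_sqrt_square[OF H])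
        moreover have "(P ** H) *v e = (l e * inverse (sqrt (l e))) *\<^sub>R e"
          using Ee e P[OF Ee[rule_format, OF e]] by (simp add: matrix_vector_mul_assoc[symmetric] matrix_vector_scaleR)
        moreover have "l e * inverse (sqrt (l e)) = sqrt (l e)"
          using l[OF e] by (simp add: real_div_sqrt divide_inverse[symmetric])
        ultimately show ?thesis by simp
      qed
      then show ?thesis by (simp add: matrix_eq_onb[OF E, of "P ** H" "mat_abs X"])
    qed
    finally show ?thesis .
  qed
  ultimately show ?thesis by (rule that)
qed

subsection \<open>Averaging over one tensor factor\<close>

text \<open>The normalised partial trace over factor \<open>j\<close>, tensored with the identity of
  that factor, written entrywise.\<close>

definition cexp :: "'n::finite \<Rightarrow> 'n qmat \<Rightarrow> 'n qmat" where
  "cexp j A = (\<chi> u v. if u j = v j then (\<Sum>a\<in>UNIV. A $ u(j := a) $ v(j := a)) / 2 else 0)"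

lemma cexp_nth:
  "cexp j A $ u $ v = (if u j = v j then (\<Sum>a\<in>UNIV. A $ u(j := a) $ v(j := a)) / 2 else 0)"
  by (simp add: cexp_def)

lemma prod_indicator:
  "finite S \<Longrightarrow> (\<Prod>k\<in>S. if P k then 1 else 0) = (if \<forall>k\<in>S. P k then 1 else (0 :: 'a :: comm_semiring_1))"
  by (induction S rule: finite_induct) auto

text \<open>In the tensor formula the factors other than \<open>j\<close> force \<open>x\<close>,
  \<open>y\<close> to agree with \<open>u\<close>, \<open>v\<close> off \<open>j\<close>; factor
  \<open>j\<close> contributes the difference of an identity term and a trace term.\<close>

lemma dq_eq: "dq j A = A - cexp j A"
proof -
  have "dq j A $ u $ v = A $ u $ v - cexp j A $ u $ v" for u v
  proof -
    let ?T = "\<lambda>k. if k = j then (\<lambda>X. X - mat (trace X / 2)) else (\<lambda>X::mat2. X)"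
    let ?P = "\<lambda>x y. \<forall>k. k \<noteq> j \<longrightarrow> u k = x k \<and> v k = y k"
    have tr: "trace (mat_unit a b) = (if a = b then 1 else 0)" for a b
      by (simp add: trace_def mat_unit_def sum.If_cases)
    have site: "(mat_unit a b - mat (trace (mat_unit a b) / 2)) $ c $ d
        = (if a = c \<and> b = d then 1 else 0) - (if c = d \<and> a = b then 1 / 2 else 0)" for a b c d
      unfolding vector_minus_component tr by (simp add: mat_unit_def mat_def)
    have T: "tensor_mat (\<lambda>k. ?T k (mat_unit (x k) (y k))) $ u $ v
        = (if x = u \<and> y = v then 1 else 0) - (if u j = v j \<and> ?P x y \<and> x j = y j then 1 / 2 else 0)" for x y
    proof -
      have "(\<Prod>k\<in>UNIV - {j}. ?T k (mat_unit (x k) (y k)) $ u k $ v k)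
          = (\<Prod>k\<in>UNIV - {j}. if u k = x k \<and> v k = y k then 1 else 0)"
        by (rule prod.cong) (auto simp: mat_unit_def)
      also have "\<dots> = (if ?P x y then 1 else 0)" by (subst prod_indicator) auto
      finally have "tensor_mat (\<lambda>k. ?T k (mat_unit (x k) (y k))) $ u $ v
        = (mat_unit (x j) (y j) - mat (trace (mat_unit (x j) (y j)) / 2)) $ u j $ v j * (if ?P x y then 1 else 0)"
        by (simp add: tensor_mat_def prod.remove[of UNIV j])
      moreover have "x = u \<and> y = v \<longleftrightarrow> ?P x y \<and> x j = u j \<and> y j = v j"
        by (auto simp: fun_eq_iff)
      ultimately show ?thesis unfolding site by (cases "?P x y") simp_all
    qed
    define Q where "Q x y \<longleftrightarrow> ?P x y \<and> x j = y j" for x y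
    have "dq j A $ u $ v = (\<Sum>x\<in>UNIV. \<Sum>y\<in>UNIV. A $ x $ y *
        ((if x = u \<and> y = v then 1 else 0) - (if u j = v j \<and> Q x y then 1 / 2 else 0)))"
      unfolding dq_def tensor_map_def by (simp only: T vec_lambda_beta Q_def)
    also have "\<dots> = (\<Sum>x\<in>UNIV. \<Sum>y\<in>UNIV. (if x = u then if y = v then A $ x $ y else 0 else 0))
        - (\<Sum>x\<in>UNIV. \<Sum>y\<in>UNIV. (if u j = v j \<and> Q x y then A $ x $ y / 2 else 0))"
      unfolding sum_subtractf[symmetric] by (intro sum.cong refl) simp
    also have "(\<Sum>x\<in>UNIV. \<Sum>y\<in>UNIV. (if x = u then if y = v then A $ x $ y else 0 else 0)) 
        = (\<Sum>x\<in>UNIV. if x = u then A $ u $ v else 0)"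
      by (intro sum.cong refl) simp
    also have "\<dots> = A $ u $ v" by simp
    also have "(\<Sum>x\<in>UNIV. \<Sum>y\<in>UNIV. (if u j = v j \<and> Q x y then A $ x $ y / 2 else 0))
        = (if u j = v j then \<Sum>x\<in>UNIV. \<Sum>y\<in>UNIV. (if Q x y then A $ x $ y / 2 else 0) else 0)"
      by simp
    also have "(\<Sum>x\<in>UNIV. \<Sum>y\<in>UNIV. (if Q x y then A $ x $ y / 2 else 0))
        = (\<Sum>p\<in>UNIV. if Q (fst p) (snd p) then A $ fst p $ snd p / 2 else 0)"
      by (simp only: sum.cartesian_product case_prod_beta' UNIV_Times_UNIV)
    also have "\<dots> = (\<Sum>p\<in>{p. Q (fst p) (snd p)}. A $ fst p $ snd p / 2)"
      by (simp add: sum.If_cases)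
    also have "\<dots> = (\<Sum>a\<in>UNIV. A $ u(j := a) $ v(j := a) / 2)" 
    proof -
      \<comment> \<open>The pairs satisfying \<open>Q\<close> are parametrised by their common value
        at \<open>j\<close>.\<close>
      have "u(j := x j) = x \<and> v(j := x j) = y" if "Q x y" for x y
        using that by (auto simp: Q_def fun_eq_iff)
      moreover have "Q (u(j := a)) (v(j := a))" for a by (simp add: Q_def)
      ultimately show ?thesis
        by (intro sum.reindex_bij_witness[of _ "\<lambda>a. (u(j := a), v(j := a))" "\<lambda>p. fst p j"]) auto
    qed
    finally show ?thesis by (simp add: cexp_nth sum_divide_distrib)
  qed
  then show ?thesis by (simp add: vec_eq_iff)
qed

lemma cexp_add: "cexp j (A + B) = cexp j A + cexp j B"
  by (simp add: vec_eq_iff cexp_nth sum.distrib add_divide_distrib)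

lemma cexp_scaleR: "cexp j (r *\<^sub>R A) = r *\<^sub>R cexp j A"
  by (simp add: vec_eq_iff cexp_nth scaleR_sum_right)

lemma cexp_sum: "cexp j (\<Sum>i\<in>I. f i) = (\<Sum>i\<in>I. cexp j (f i))"
  by (induction I rule: infinite_finite_induct) (simp_all add: cexp_add cexp_scaleR[of j 0 0, simplified])

lemma cexp_adj: "cexp j (adj A) = adj (cexp j A)"
  by (auto simp: vec_eq_iff cexp_nth adj_def)

lemma cexp_idem: "cexp j (cexp j A) = cexp j A"
  by (simp add: vec_eq_iff cexp_nth)

lemma cexp_commute: "cexp i (cexp j A) = cexp j (cexp i A)"
proof (cases "i = j")
  case False
  have "(\<Sum>a\<in>UNIV. \<Sum>b\<in>UNIV. A $ u(i := a, j := b) $ v(i := a, j := b))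
      = (\<Sum>a\<in>UNIV. \<Sum>b\<in>UNIV. A $ u(j := a, i := b) $ v(j := a, i := b))" for u v
    by (subst sum.swap) (simp add: fun_upd_twist[OF False])
  then show ?thesis using False by (simp add: vec_eq_iff cexp_nth sum_divide_distrib[symmetric])
qed simp

lemma trace_cexp: "trace (cexp j A) = trace A"
proof -
  have "trace (cexp j A) = (\<Sum>p\<in>UNIV. A $ (fst p)(j := snd p) $ (fst p)(j := snd p) / 2)"
    by (simp add: trace_def cexp_nth UNIV_Times_UNIV[symmetric] sum.cartesian_product'
        sum_divide_distrib del: UNIV_Times_UNIV)
  also have "\<dots> = (\<Sum>p\<in>(UNIV :: (('a \<Rightarrow> 2) \<times> 2) set). A $ fst p $ fst p / 2)"
    by (rule sum.reindex_bij_witness[of _ "\<lambda>p. ((fst p)(j := snd p), fst p j)" "\<lambda>p. ((fst p)(j := snd p), fst p j)"]) auto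
  also have "\<dots> = trace A"
    by (simp add: trace_def UNIV_Times_UNIV[symmetric] sum.cartesian_product' del: UNIV_Times_UNIV)
  finally show ?thesis .
qed

text \<open>Both sides are sums over triples \<open>(u, v, a)\<close> with \<open>u j = v j\<close>;
  exchanging the common value at \<open>j\<close> with \<open>a\<close> is an involution that
  carries one sum to the other.\<close>

lemma inner_cexp: "inner (cexp j X) Y = inner X (cexp j Y)"
proof -
  let ?S = "{(u, v, a :: 2). u j = v j} :: (('a \<Rightarrow> 2) \<times> ('a \<Rightarrow> 2) \<times> 2) set"
  have conv: "(\<Sum>u\<in>UNIV. \<Sum>v\<in>UNIV. if u j = v j then \<Sum>a\<in>UNIV. f u v a else 0) = (\<Sum>(u, v, a)\<in>?S. f u v a)"
    for f :: "_ \<Rightarrow> _ \<Rightarrow> _ \<Rightarrow> real"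
  proof -
    have "(\<Sum>(u, v, a)\<in>?S. f u v a) = (\<Sum>(u, v, a)\<in>UNIV. if u j = v j then f u v a else 0)"
      by (rule sum.mono_neutral_cong_left) (auto split: if_splits)
    also have "\<dots> = (\<Sum>u\<in>UNIV. \<Sum>v\<in>UNIV. \<Sum>a\<in>UNIV. if u j = v j then f u v a else 0)"
      by (simp add: UNIV_Times_UNIV[symmetric] sum.cartesian_product' del: UNIV_Times_UNIV)
    also have "\<dots> = (\<Sum>u\<in>UNIV. \<Sum>v\<in>UNIV. if u j = v j then \<Sum>a\<in>UNIV. f u v a else 0)"
      by (intro sum.cong refl) simp
    finally show ?thesis by simp
  qed
  have 1: "inner (cexp j X) Y = (\<Sum>(u, v, a)\<in>?S. inner (X $ u(j := a) $ v(j := a)) (Y $ u $ v) / 2)"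
    unfolding conv[symmetric]
    by (auto simp: inner_vec_def cexp_nth inner_sum_left sum_divide_distrib intro!: sum.cong)
       (simp add: inner_complex_def field_simps)
  have 2: "inner X (cexp j Y) = (\<Sum>(u, v, a)\<in>?S. inner (X $ u $ v) (Y $ u(j := a) $ v(j := a)) / 2)"
    unfolding conv[symmetric]
    by (auto simp: inner_vec_def cexp_nth inner_sum_right sum_divide_distrib intro!: sum.cong)
       (simp add: inner_complex_def field_simps)
  show ?thesis
    unfolding 1 2
    by (rule sum.reindex_bij_witness[of _ "\<lambda>(u, v, a). (u(j := a), v(j := a), u j)" "\<lambda>(u, v, a). (u(j := a), v(j := a), u j)"])
      (auto, metis fun_upd_triv)
qed

text \<open>A coordinate where \<open>u\<close> and \<open>v\<close> differ kills the off-diagonal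
  entry; diagonal entries are unchanged when one coordinate is altered, so altering them one at a
  time makes all of them equal.\<close>

lemma cexp_fixed_imp_scalar:
  fixes X :: "('n::finite) qmat"
  assumes fixed: "\<And>j. cexp j X = X"
  shows "X = mat (trace X / 2 ^ CARD('n))"
proof -
  have off: "X $ u $ v = 0" if uv: "u \<noteq> v" for u v
  proof -
    obtain j where "u j \<noteq> v j" using uv by (auto simp: fun_eq_iff)
    then show ?thesis using fixed[of j] by (metis cexp_nth)
  qed
  have upd: "X $ u(j := a) $ u(j := a) = X $ u $ u" for u j a
    by (subst (1 2) fixed[of j, symmetric]) (simp add: cexp_nth)
  have diag: "X $ w $ w = X $ u $ u" for u w
  proof -
    have "X $ (\<lambda>k. if k \<in> S then w k else u k) $ (\<lambda>k. if k \<in> S then w k else u k) = X $ u $ u" if "finite S" for S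
      using that
    proof induction
      case (insert j S)
      have "(\<lambda>k. if k \<in> insert j S then w k else u k) = (\<lambda>k. if k \<in> S then w k else u k)(j := w j)" by auto
      then show ?case using insert by (simp only: upd)
    qed simp
    from this[of UNIV] show ?thesis by simp
  qed
  have "trace X = 2 ^ CARD('n) * X $ u $ u" for u
    unfolding trace_def by (subst diag[of _ u]) (simp add: card_fun)
  then have "X $ u $ u = trace X / 2 ^ CARD('n)" for u by (simp add: field_simps)
  then show ?thesis using off by (simp add: vec_eq_iff mat_def)
qed

text \<open>The \<open>U p\<close> are the four Pauli matrices on factor \<open>j\<close>, up to
  phase: \<open>fst p\<close> selects the bit flip and \<open>snd p\<close> the sign. Summing over
  signs removes entries with \<open>u j \<noteq> v j\<close>; summing over flips produces the
  partial trace.\<close>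

lemma cexp_twirl:
  obtains U :: "2 \<times> 2 \<Rightarrow> ('n::finite) qmat"
  where "\<forall>p. adj (U p) ** U p = mat 1"
    "\<forall>A. cexp j A = (1 / 4) *\<^sub>R (\<Sum>p\<in>UNIV. U p ** A ** adj (U p))"
proof
  define s where "s b c = (if b = 1 \<and> c = 1 then - 1 else 1 :: complex)" for b c :: 2
  define U :: "2 \<times> 2 \<Rightarrow> 'n qmat"
    where "U p = (\<chi> u v. if v = u(j := u j + fst p) then s (snd p) (u j) else 0)" for p
  \<comment> \<open>Arithmetic in the type \<open>2\<close> is modulo 2, so each flip is its own
    inverse.\<close>
  have two: "c + a + a = c" for c a :: 2 using exhaust_2[of a] by auto
  have inv: "v = u(j := u j + a) \<longleftrightarrow> u = v(j := v j + a)" for u v :: "'n \<Rightarrow> 2" and a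
    by (auto simp: two)
  have ss: "s b c * s b c = 1" "cnj (s b c) = s b c" for b c by (simp_all add: s_def)
  have "adj (U p) ** U p = mat 1" for p
  proof -
    have "(\<Sum>w\<in>UNIV. cnj (U p $ w $ u) * U p $ w $ v) = (if u = v then 1 else 0)" for u v
    proof -
      have "(\<Sum>w\<in>UNIV. cnj (U p $ w $ u) * U p $ w $ v)
          = (\<Sum>w\<in>UNIV. if w = u(j := u j + fst p) then (if u = v then 1 else 0) else 0)"
      proof (rule sum.cong[OF refl])
        fix w
        show "cnj (U p $ w $ u) * U p $ w $ v = (if w = u(j := u j + fst p) then (if u = v then 1 else 0) else 0)"
          unfolding U_def by (auto simp: inv[of _ w] ss) (metis inv)+
      qed
      then show ?thesis by simp
    qed
    then show ?thesis by (simp add: vec_eq_iff matrix_matrix_mult_def adj_def mat_def)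
  qed
  then show "\<forall>p. adj (U p) ** U p = mat 1" by blast
  have "cexp j A = (1 / 4) *\<^sub>R (\<Sum>p\<in>UNIV. U p ** A ** adj (U p))" for A
  proof -
    have entry: "(U p ** A ** adj (U p)) $ u $ v
        = s (snd p) (u j) * s (snd p) (v j) * A $ u(j := u j + fst p) $ v(j := v j + fst p)" for p u v
    proof -
      have "(U p ** A) $ u $ w = s (snd p) (u j) * A $ u(j := u j + fst p) $ w" for w
        by (simp add: U_def matrix_matrix_mult_def if_distrib[of "\<lambda>t. t * _"] cong: if_cong)
      then show ?thesis
        by (subst matrix_matrix_mult_def)
           (simp add: U_def adj_def if_distrib[of cnj] if_distrib[of "\<lambda>t. _ * t"] ss mult_ac cong: if_cong)
    qed
    have sb: "(\<Sum>b\<in>UNIV. s b c * s b d) = (if c = d then 2 else 0)" for c d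
      using exhaust_2[of c] exhaust_2[of d] by (auto simp: s_def sum_2)
    have "((1 / 4) *\<^sub>R (\<Sum>p\<in>UNIV. U p ** A ** adj (U p))) $ u $ v = cexp j A $ u $ v" for u v
    proof -
      have "(\<Sum>p\<in>UNIV. U p ** A ** adj (U p)) $ u $ v
          = (\<Sum>a\<in>UNIV. \<Sum>b\<in>UNIV. s b (u j) * s b (v j) * A $ u(j := u j + a) $ v(j := v j + a))"
        by (simp add: entry UNIV_Times_UNIV[symmetric] sum.cartesian_product' del: UNIV_Times_UNIV)
      also have "\<dots> = (\<Sum>a\<in>UNIV. (if u j = v j then 2 else 0) * A $ u(j := u j + a) $ v(j := v j + a))"
        by (simp only: sum_distrib_right[symmetric] sb)
      also have "\<dots> = (if u j = v j then 2 * (\<Sum>a\<in>UNIV. A $ u(j := u j + a) $ v(j := u j + a)) else 0)"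
        by (simp add: sum_distrib_left)
      also have "(\<Sum>a\<in>UNIV. A $ u(j := u j + a) $ v(j := u j + a)) = (\<Sum>a\<in>UNIV. A $ u(j := a) $ v(j := a))"
        by (rule sum.reindex_bij_witness[of _ "\<lambda>a. a - u j" "\<lambda>a. u j + a"]) auto
      finally show ?thesis by (simp add: cexp_nth) (simp add: scaleR_conv_of_real)
    qed
    then show ?thesis by (simp add: vec_eq_iff)
  qed
  then show "\<forall>A. cexp j A = (1 / 4) *\<^sub>R (\<Sum>p\<in>UNIV. U p ** A ** adj (U p))" by blast
qed

lemma unitary_norm:
  fixes U :: "complex^'i::finite^'i"
  assumes "adj U ** U = mat 1"
  shows "norm (U *v v) = norm v" "norm (adj U *v v) = norm v"
proof -
  have "U ** adj U = mat 1" using assms matrix_left_right_inverse by blast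
  with assms show "norm (U *v v) = norm v" "norm (adj U *v v) = norm v"
    by (simp_all add: norm_eq inner_adj matrix_vector_mul_assoc)
qed

text \<open>A mean of unitary conjugates of a contraction is a contraction, by the triangle
  inequality.\<close>

lemma cexp_contraction:
  assumes "\<And>v. norm (B *v v) \<le> norm v"
  shows "norm (cexp j B *v v) \<le> norm v"
proof -
  obtain U :: "2 \<times> 2 \<Rightarrow> 'a qmat" where "\<forall>p. adj (U p) ** U p = mat 1"
    "\<forall>A. cexp j A = (1 / 4) *\<^sub>R (\<Sum>p\<in>UNIV. U p ** A ** adj (U p))"
    by (rule cexp_twirl)
  then have U: "adj (U p) ** U p = mat 1"
    "cexp j A = (1 / 4) *\<^sub>R (\<Sum>p\<in>UNIV. U p ** A ** adj (U p))" for p A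
    by blast+
  have "norm (\<Sum>p\<in>UNIV. (U p ** B ** adj (U p)) *v v) \<le> (\<Sum>p\<in>(UNIV :: (2 \<times> 2) set). norm v)"
  proof (rule sum_norm_le)
    show "norm ((U p ** B ** adj (U p)) *v v) \<le> norm v" for p
      using assms[of "adj (U p) *v v"]
      by (simp add: matrix_vector_mul_assoc[symmetric] unitary_norm[OF U(1)])
  qed
  then show ?thesis
    by (simp add: U(2) sum_matrix_vector_mult scaleR_matrix_vector)
qed

text \<open>\<open>cexp j A *v v\<close> is the mean of the four vectors
  \<open>U p *v (A *v (adj (U p) *v v))\<close>, and the squared norm of a mean is at most the mean
  of the squared norms, which is the right-hand side.\<close>

lemma cexp_Kadison_Schwarz:
  "(norm (cexp j A *v v))\<^sup>2 \<le> inner v (cexp j (adj A ** A) *v v)"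
proof -
  obtain U :: "2 \<times> 2 \<Rightarrow> 'a qmat" where "\<forall>p. adj (U p) ** U p = mat 1"
    "\<forall>A. cexp j A = (1 / 4) *\<^sub>R (\<Sum>p\<in>UNIV. U p ** A ** adj (U p))"
    by (rule cexp_twirl)
  then have U: "adj (U p) ** U p = mat 1"
    "cexp j A = (1 / 4) *\<^sub>R (\<Sum>p\<in>UNIV. U p ** A ** adj (U p))" for p A
    by blast+
  let ?f = "\<lambda>p. A *v (adj (U p) *v v)"
  have "norm (\<Sum>p\<in>UNIV. (U p ** A ** adj (U p)) *v v) \<le> (\<Sum>p\<in>UNIV. norm (?f p))"
    by (rule sum_norm_le) (simp add: matrix_vector_mul_assoc[symmetric] unitary_norm[OF U(1)])
  then have "(norm (\<Sum>p\<in>UNIV. (U p ** A ** adj (U p)) *v v))\<^sup>2 \<le> (\<Sum>p\<in>UNIV. norm (?f p))\<^sup>2"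
    by (rule power_mono) simp
  also have "\<dots> \<le> 4 * (\<Sum>p\<in>UNIV. (norm (?f p))\<^sup>2)"
    using sum_squared_le_sum_of_squares[of "\<lambda>p. norm (?f p)" UNIV] by simp
  also have "(\<Sum>p\<in>UNIV. (norm (?f p))\<^sup>2) = 4 * inner v (cexp j (adj A ** A) *v v)"
    by (simp add: U(2) sum_matrix_vector_mult scaleR_matrix_vector inner_sum_right
        power2_norm_eq_inner matrix_vector_mul_assoc[symmetric] inner_adj)
  finally show ?thesis
    by (simp add: U(2) sum_matrix_vector_mult scaleR_matrix_vector power_divide)
qed

subsection \<open>The first inequality\<close>

interpretation cexp: comp_fun_idem "cexp :: 'n::finite \<Rightarrow> 'n qmat \<Rightarrow> 'n qmat"
  by standard (simp_all add: fun_eq_iff cexp_commute cexp_idem)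

text \<open>The composition of the \<open>cexp j\<close> for \<open>j \<in> T\<close>. The fold is
  independent of the order because these maps commute, and idempotence lets
  \<open>avg_insert\<close> hold even when \<open>j \<in> T\<close>.\<close>

definition avg :: "('n::finite) set \<Rightarrow> 'n qmat \<Rightarrow> 'n qmat" where
  "avg T B = Finite_Set.fold cexp B T"

lemma avg_empty: "avg {} B = B"
  by (simp add: avg_def)

lemma avg_insert: "avg (insert j T) B = cexp j (avg T B)"
  by (simp add: avg_def)

lemma avg_contraction:
  assumes "\<And>v. norm (B *v v) \<le> norm v"
  shows "norm (avg T B *v v) \<le> norm v"
  using finite[of T]
  by (induction arbitrary: v) (simp_all add: avg_empty avg_insert assms cexp_contraction)

lemma trace_avg: "trace (avg T B) = trace B"
  using finite[of T] by induction (simp_all add: avg_empty avg_insert trace_cexp)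

lemma avg_UNIV:
  fixes B :: "('n::finite) qmat"
  shows "avg UNIV B = mat (trace B / 2 ^ CARD('n))"
proof -
  have "cexp j (avg UNIV B) = avg UNIV B" for j
    by (simp add: avg_insert[symmetric] insert_absorb)
  from cexp_fixed_imp_scalar[OF this] show ?thesis by (simp add: trace_avg)
qed

section \<open>Product laws on sets of coordinates and their centred indicators\<close>

text \<open>\<open>wt r\<close> is the law of a random set containing each coordinate independently with probability \<open>r\<close>.\<close>

definition wt :: "real \<Rightarrow> ('n::finite) set \<Rightarrow> real" where
  "wt r S = (\<Prod>k\<in>UNIV. if k \<in> S then r else 1 - r)"

text \<open>The indicator of \<open>j \<in> S\<close> minus its mean \<open>r\<close> under
  \<open>wt r\<close>.\<close>

definition ctr :: "real \<Rightarrow> 'n::finite \<Rightarrow> 'n set \<Rightarrow> real" where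
  "ctr r j S = (if j \<in> S then 1 - r else - r)"

lemma sum_sets_prod:
  fixes f g :: "'n::finite \<Rightarrow> real"
  shows "(\<Sum>S\<in>UNIV. \<Prod>k\<in>UNIV. if k \<in> S then f k else g k) = (\<Prod>k\<in>UNIV. f k + g k)"
  by (simp add: prod_add prod.If_cases Compl_eq_Diff_UNIV)

lemma sum_wt: "(\<Sum>S\<in>UNIV. wt r S) = 1"
  by (simp add: wt_def sum_sets_prod)

text \<open>All three functions are products over coordinates, so the expectation factorises; for
  \<open>i \<noteq> j\<close> the factor at \<open>i\<close> is the mean of a centred indicator,
  which is 0.\<close>

lemma sum_wt_ctr_ctr:
  "(\<Sum>S\<in>UNIV. wt r S * (ctr r i S * ctr r j S)) = (if i = j then r * (1 - r) else 0)"
proof -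
  let ?f = "\<lambda>k. r * (if k = i then 1 - r else 1) * (if k = j then 1 - r else 1)"
  let ?g = "\<lambda>k. (1 - r) * (if k = i then - r else 1) * (if k = j then - r else 1)"
  have c: "ctr r i S = (\<Prod>k\<in>UNIV. if k \<in> S then (if k = i then 1 - r else 1) else (if k = i then - r else 1))" for i S
  proof -
    have "ctr r i S = (\<Prod>k\<in>UNIV. if k = i then ctr r i S else 1)" by simp
    also have "\<dots> = (\<Prod>k\<in>UNIV. if k \<in> S then (if k = i then 1 - r else 1) else (if k = i then - r else 1))"
      by (rule prod.cong) (auto simp: ctr_def)
    finally show ?thesis .
  qed
  have "wt r S * (ctr r i S * ctr r j S) = (\<Prod>k\<in>UNIV. if k \<in> S then ?f k else ?g k)" for S
    unfolding wt_def c[of i] c[of j] prod.distrib[symmetric] by (rule prod.cong) auto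
  then have "(\<Sum>S\<in>UNIV. wt r S * (ctr r i S * ctr r j S)) = (\<Prod>k\<in>UNIV. ?f k + ?g k)"
    by (simp only: sum_sets_prod)
  also have "\<dots> = (if i = j then r * (1 - r) else 0)"
  proof (cases "i = j")
    case True
    have "(\<Prod>k\<in>UNIV. ?f k + ?g k) = (\<Prod>k\<in>UNIV. if k = i then r * (1 - r) else 1)"
      using True by (intro prod.cong) (auto simp: algebra_simps)
    then show ?thesis using True by simp
  next
    case False
    then have "?f i + ?g i = 0" by simp
    then have "\<exists>k\<in>UNIV. ?f k + ?g k = 0" by (intro bexI[of _ i]) auto
    then have "(\<Prod>k\<in>UNIV. ?f k + ?g k) = 0" by (rule prod_zero[OF finite])
    then show ?thesis using False by simp
  qed
  finally show ?thesis .
qed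

text \<open>Apart from the common factors off \<open>j\<close>, the two sides carry
  \<open>r * (1 - r)\<close> and \<open>(1 - r) * (- r)\<close>.\<close>

lemma wt_ctr_toggle: "wt r (insert j S) * ctr r j (insert j S) = - (wt r (S - {j}) * ctr r j (S - {j}))"
proof -
  have "wt r T = (if j \<in> T then r else 1 - r) * (\<Prod>k\<in>UNIV - {j}. if k \<in> T then r else 1 - r)" for T
    unfolding wt_def by (subst prod.remove[of UNIV j]) auto
  moreover have "(\<Prod>k\<in>UNIV - {j}. if k \<in> insert j S then r else 1 - r) = (\<Prod>k\<in>UNIV - {j}. if k \<in> S - {j} then r else 1 - r)"
    by (rule prod.cong) auto
  ultimately show ?thesis by (simp add: ctr_def)
qed

lemma wt_nonneg: "0 \<le> r \<Longrightarrow> r \<le> 1 \<Longrightarrow> 0 \<le> wt r S"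
  unfolding wt_def by (intro prod_nonneg) auto

lemma wt_0: "wt 0 S = (if S = {} then 1 else 0)"
  unfolding wt_def by (auto simp: prod_indicator if_distrib cong: if_cong)

lemma wt_1: "wt 1 S = (if S = UNIV then 1 else 0)"
  unfolding wt_def by (auto simp: prod_indicator)

text \<open>A Russo-Margulis formula: the logarithmic derivative of the factor at \<open>j\<close>
  is \<open>ctr r j S / (r * (1 - r))\<close>.\<close>

lemma wt_deriv:
  assumes "0 < r" "r < 1"
  shows "((\<lambda>r. wt r S) has_real_derivative (wt r S * (\<Sum>j\<in>UNIV. ctr r j S)) / (r * (1 - r))) (at r)"
proof -
  have "((\<lambda>r. wt r S) has_real_derivative (wt r S * (\<Sum>j\<in>UNIV. (if j \<in> S then 1 else - 1) / (if j \<in> S then r else 1 - r)))) (at r)"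
    unfolding wt_def
    by (rule has_field_derivative_prod') (use assms in \<open>auto intro!: derivative_eq_intros\<close>)
  moreover have "(\<Sum>j\<in>UNIV. (if j \<in> S then 1 else - 1) / (if j \<in> S then r else 1 - r)) = (\<Sum>j\<in>UNIV. ctr r j S) / (r * (1 - r))"
    unfolding sum_divide_distrib using assms by (intro sum.cong) (auto simp: ctr_def divide_simps)
  ultimately show ?thesis by simp
qed

text \<open>With \<open>p / c\<close> the projection of \<open>f\<close> onto the span of the
  \<open>\<psi> j\<close>, the inequality expands the nonnegative weighted square of
  \<open>c *\<^sub>R f S - p S\<close>. The common squared norm \<open>c\<close> of the
  \<open>\<psi> j\<close> is the constant in the bound.\<close>

lemma weighted_Bessel:
  fixes f :: "'s \<Rightarrow> 'a::real_inner" and w :: "'s \<Rightarrow> real" and \<psi> :: "'k \<Rightarrow> 's \<Rightarrow> real"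
  assumes "finite J" and w: "\<And>S. S \<in> \<Omega> \<Longrightarrow> 0 \<le> w S" and c: "0 < c"
    and orth: "\<And>i j. i \<in> J \<Longrightarrow> j \<in> J \<Longrightarrow> (\<Sum>S\<in>\<Omega>. w S * (\<psi> i S * \<psi> j S)) = (if i = j then c else 0)"
  shows "(\<Sum>j\<in>J. (norm (\<Sum>S\<in>\<Omega>. (w S * \<psi> j S) *\<^sub>R f S))\<^sup>2) \<le> c * (\<Sum>S\<in>\<Omega>. w S * (norm (f S))\<^sup>2)"
proof -
  define a where "a j = (\<Sum>S\<in>\<Omega>. (w S * \<psi> j S) *\<^sub>R f S)" for j
  define p where "p S = (\<Sum>j\<in>J. \<psi> j S *\<^sub>R a j)" for S
  let ?N = "\<Sum>j\<in>J. inner (a j) (a j)"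
  have fp: "(\<Sum>S\<in>\<Omega>. w S * inner (f S) (p S)) = ?N"
  proof -
    have "(\<Sum>S\<in>\<Omega>. w S * inner (f S) (p S)) = (\<Sum>S\<in>\<Omega>. \<Sum>j\<in>J. inner ((w S * \<psi> j S) *\<^sub>R f S) (a j))"
      by (simp add: p_def inner_sum_right sum_distrib_left mult_ac)
    also have "\<dots> = (\<Sum>j\<in>J. inner (\<Sum>S\<in>\<Omega>. (w S * \<psi> j S) *\<^sub>R f S) (a j))"
      by (subst sum.swap) (simp only: inner_sum_left)
    finally show ?thesis by (simp only: a_def[symmetric])
  qed
  have pp: "(\<Sum>S\<in>\<Omega>. w S * inner (p S) (p S)) = c * ?N"
  proof -
    have "(\<Sum>S\<in>\<Omega>. w S * inner (p S) (p S)) = (\<Sum>S\<in>\<Omega>. \<Sum>i\<in>J. \<Sum>j\<in>J. w S * (\<psi> i S * \<psi> j S) * inner (a j) (a i))"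
      by (simp add: p_def inner_sum_right inner_sum_left sum_distrib_left mult_ac)
    also have "\<dots> = (\<Sum>i\<in>J. \<Sum>j\<in>J. (\<Sum>S\<in>\<Omega>. w S * (\<psi> i S * \<psi> j S)) * inner (a j) (a i))"
      unfolding sum_distrib_right by (subst sum.swap, intro sum.cong refl, rule sum.swap)
    also have "\<dots> = (\<Sum>i\<in>J. \<Sum>j\<in>J. if i = j then c * inner (a i) (a i) else 0)"
      by (intro sum.cong refl) (simp add: orth)
    also have "\<dots> = c * ?N" using \<open>finite J\<close> by (simp add: sum_distrib_left)
    finally show ?thesis .
  qed
  have "0 \<le> (\<Sum>S\<in>\<Omega>. w S * inner (c *\<^sub>R f S - p S) (c *\<^sub>R f S - p S))"
    using w by (intro sum_nonneg) simp
  also have "\<dots> = c\<^sup>2 * (\<Sum>S\<in>\<Omega>. w S * inner (f S) (f S)) - 2 * c * (\<Sum>S\<in>\<Omega>. w S * inner (f S) (p S))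
      + (\<Sum>S\<in>\<Omega>. w S * inner (p S) (p S))"
    unfolding sum_distrib_left sum.distrib[symmetric] sum_subtractf[symmetric]
    by (intro sum.cong refl) (simp add: inner_diff_left inner_diff_right inner_commute power2_eq_square algebra_simps)
  also have "\<dots> = c * (c * (\<Sum>S\<in>\<Omega>. w S * inner (f S) (f S)) - ?N)"
    unfolding fp pp by (simp add: power2_eq_square algebra_simps)
  finally show ?thesis
    using c by (simp add: zero_le_mult_iff a_def power2_norm_eq_inner)
qed

text \<open>\<open>infl B r j\<close> is the covariance of \<open>avg (- S) B\<close> and the indicator of \<open>j \<in> S\<close> under \<open>wt r\<close>.\<close>

definition infl :: "('n::finite) qmat \<Rightarrow> real \<Rightarrow> 'n \<Rightarrow> 'n qmat" where
  "infl B r j = (\<Sum>S\<in>UNIV. (wt r S * ctr r j S) *\<^sub>R avg (- S) B)"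

text \<open>Toggling \<open>j\<close> in \<open>S\<close> preserves \<open>insert j (- S)\<close>
  and reverses the sign of the weight, so the terms cancel in pairs.\<close>

lemma cexp_infl: "cexp j (infl B r j) = 0"
proof -
  define X where "X = cexp j (infl B r j)"
  define g where "g S = (wt r S * ctr r j S) *\<^sub>R avg (insert j (- S)) B" for S
  let ?t = "\<lambda>S. if j \<in> S then S - {j} else insert j S"
  have X: "X = (\<Sum>S\<in>UNIV. g S)"
    by (simp add: X_def g_def infl_def cexp_sum cexp_scaleR avg_insert)
  also have "\<dots> = (\<Sum>S\<in>UNIV. - g S)"
  proof (rule sum.reindex_bij_witness[of _ ?t ?t])
    fix S
    have "insert j (- ?t S) = insert j (- S)" by auto
    moreover have "wt r (?t S) * ctr r j (?t S) = - (wt r S * ctr r j S)"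
      using wt_ctr_toggle[of r j S] by (auto simp: insert_absorb)
    ultimately show "- g (?t S) = g S" by (simp only: g_def) simp
  qed auto
  also have "\<dots> = - X" by (simp add: X sum_negf)
  finally have "X + X = 0" by (simp add: eq_neg_iff_add_eq_0)
  then show ?thesis by (simp add: X_def flip: scaleR_2)
qed

text \<open>\<open>A\<close> and \<open>dq j A\<close> differ by \<open>cexp j A\<close>, which is
  orthogonal to \<open>infl B r j\<close> because \<open>cexp j\<close> is self-adjoint and kills
  \<open>infl B r j\<close>.\<close>

lemma inner_infl_dq: "inner (infl B r j) A = inner (infl B r j) (dq j A)"
  by (simp add: dq_eq inner_diff_right inner_cexp[symmetric] cexp_infl)

text \<open>For fixed \<open>v\<close>, Bessel's inequality applies to the vectors
  \<open>avg (- S) B *v v\<close>, each of norm at most \<open>norm v\<close>.\<close>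

lemma infl_column_bound:
  assumes B: "\<And>v. norm (B *v v) \<le> norm v" and r: "0 < r" "r < 1"
  shows "(\<Sum>j\<in>UNIV. (norm (infl B r j *v v))\<^sup>2) \<le> r * (1 - r) * (norm v)\<^sup>2"
proof -
  have "(\<Sum>j\<in>UNIV. (norm (infl B r j *v v))\<^sup>2)
      = (\<Sum>j\<in>UNIV. (norm (\<Sum>S\<in>UNIV. (wt r S * ctr r j S) *\<^sub>R (avg (- S) B *v v)))\<^sup>2)"
    by (simp add: infl_def sum_matrix_vector_mult scaleR_matrix_vector)
  also have "\<dots> \<le> r * (1 - r) * (\<Sum>S\<in>UNIV. wt r S * (norm (avg (- S) B *v v))\<^sup>2)"
    using r by (intro weighted_Bessel) (auto simp: wt_nonneg sum_wt_ctr_ctr)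
  also have "\<dots> \<le> r * (1 - r) * (\<Sum>S\<in>UNIV. wt r (S :: 'a set) * (norm v)\<^sup>2)"
    using r by (intro mult_left_mono sum_mono power_mono avg_contraction[OF B]) (auto simp: wt_nonneg)
  also have "\<dots> = r * (1 - r) * (norm v)\<^sup>2"
    by (simp add: sum_distrib_right[symmetric] sum_wt)
  finally show ?thesis .
qed

lemma Poincare_dual:
  fixes A B M :: "('n::finite) qmat"
  assumes B: "\<And>v. norm (B *v v) \<le> norm v"
    and M: "psd M" and MM: "M ** M = (\<Sum>j\<in>UNIV. adj (dq j A) ** dq j A)"
  shows "inner B A - inner (mat (trace B / 2 ^ CARD('n))) A \<le> pi * Re (trace M)"
proof -
  define \<phi> where "\<phi> r = (\<Sum>S\<in>UNIV. wt r S * inner (avg (- S) B) A)" for r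
  define m where "m = Re (trace M)"
  \<comment> \<open>\<open>arcsin (2 * r - 1)\<close> is an antiderivative of
    \<open>1 / sqrt (r * (1 - r))\<close> and increases by \<open>pi\<close> over the unit interval.
    Its derivative blows up at both ends, so monotonicity of \<open>h\<close> uses continuity there
    and the derivative only inside.\<close>
  define h where "h r = \<phi> r - m * arcsin (2 * r - 1)" for r
  have cont: "continuous_on {0..1} (\<lambda>r::real. if k \<in> S then r else 1 - r)" for k :: 'n and S
    by (cases "k \<in> S") (auto intro!: continuous_intros)
  have "h 1 \<le> h 0"
  proof (rule DERIV_nonpos_imp_decreasing_open[of 0 1 h])
    show "continuous_on {0..1} h"
      unfolding h_def \<phi>_def wt_def by (intro continuous_intros cont) auto
  next
    fix r :: real assume r: "0 < r" "r < 1"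
    define q where "q = sqrt (r * (1 - r))"
    have q: "q > 0" "q * q = r * (1 - r)" using r by (simp_all add: q_def)
    have "(\<phi> has_real_derivative (\<Sum>S\<in>UNIV. (wt r S * (\<Sum>j\<in>UNIV. ctr r j S)) / (r * (1 - r)) * inner (avg (- S) B) A)) (at r)"
      unfolding \<phi>_def[abs_def] using r by (intro DERIV_sum DERIV_cmult_right wt_deriv)
    moreover have "(\<Sum>S\<in>UNIV. (wt r S * (\<Sum>j\<in>UNIV. ctr r j S)) / (r * (1 - r)) * inner (avg (- S) B) A)
        = (\<Sum>j\<in>UNIV. inner (infl B r j) A) / (q * q)"
    proof -
      have "(\<Sum>j\<in>UNIV. inner (infl B r j) A) = (\<Sum>S\<in>UNIV. wt r S * (\<Sum>j\<in>UNIV. ctr r j S) * inner (avg (- S) B) A)"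
        unfolding infl_def inner_sum_left
        by (subst sum.swap) (simp add: sum_distrib_left sum_distrib_right mult.assoc)
      then show ?thesis by (simp add: q sum_divide_distrib)
    qed
    moreover have "((\<lambda>r. arcsin (2 * r - 1)) has_real_derivative 1 / q) (at r)"
    proof -
      have "1 - (2 * r - 1)\<^sup>2 = (2 * q)\<^sup>2" using q by (simp add: power2_eq_square algebra_simps)
      then have "sqrt (1 - (2 * r - 1)\<^sup>2) = 2 * q" using q by (simp only: real_sqrt_abs)
      then show ?thesis using r by (auto intro!: derivative_eq_intros simp: field_simps)
    qed
    ultimately have "(h has_real_derivative (\<Sum>j\<in>UNIV. inner (infl B r j) A) / (q * q) - m * (1 / q)) (at r)"
      unfolding h_def[abs_def] by (intro DERIV_diff DERIV_cmult) simp_all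
    moreover have "(\<Sum>j\<in>UNIV. inner (infl B r j) A) / (q * q) - m * (1 / q) \<le> 0"
    proof -
      \<comment> \<open>The column bound has constant \<open>q * q\<close>, so the Hoelder
        inequality gives \<open>q * m\<close>; one of the two factors \<open>q\<close> in the
        denominator cancels.\<close>
      have "(\<Sum>j\<in>UNIV. inner (infl B r j) A) = (\<Sum>j\<in>UNIV. inner (infl B r j) (dq j A))"
        by (rule sum.cong[OF refl inner_infl_dq])
      also have "\<dots> \<le> q * m"
        unfolding m_def using infl_column_bound[OF B r] q
        by (intro column_Hoelder[OF M MM]) (simp_all add: power2_eq_square)
      finally show ?thesis using q by (simp add: field_simps)
    qed
    ultimately show "\<exists>y. DERIV h r :> y \<and> y \<le> 0" by blast
  qed simp
  \<comment> \<open>At the endpoints the law is a point mass: at 1 nothing is averaged, at 0 every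
    factor is.\<close>
  moreover have "\<phi> 1 = inner B A"
    by (simp add: \<phi>_def wt_1 if_distrib[of "\<lambda>t. t * _"] avg_empty cong: if_cong)
  moreover have "\<phi> 0 = inner (mat (trace B / 2 ^ CARD('n))) A"
    by (simp add: \<phi>_def wt_0 if_distrib[of "\<lambda>t. t * _"] avg_UNIV cong: if_cong)
  ultimately show ?thesis by (simp add: h_def m_def algebra_simps)
qed

section \<open>From the dual estimate to the normalised trace norm\<close>

lemma inner_mat_left: "inner (mat c) A = Re (cnj c * trace A)" for A :: "complex^'i::finite^'i"
proof -
  have "inner (mat c) A = (\<Sum>i\<in>UNIV. inner c (A $ i $ i))"
    by (simp add: inner_vec_def mat_def if_distrib[of "\<lambda>t. inner t _"] cong: if_cong)
  then show ?thesis by (simp add: trace_def inner_complex_def sum_distrib_left sum.distrib)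
qed

lemma norm1_mat_sqrt:
  fixes H :: "('n::finite) qmat"
  assumes "psd H"
  shows "norm1 (mat_sqrt H) = Re (trace (mat_sqrt H)) / 2 ^ CARD('n)"
proof -
  have "mat_abs (mat_sqrt H) = mat_sqrt H"
    using psd_mat_sqrt[OF assms] mat_sqrt_square[OF assms] by (simp add: mat_abs_def psd_iff)
  then show ?thesis by (simp add: norm1_def)
qed

lemma Poincare_norm1:
  fixes A :: "('n::finite) qmat"
  shows "norm1 (A - mat (trace A / 2 ^ CARD('n)))
    \<le> pi * norm1 (mat_sqrt (\<Sum>j\<in>UNIV. adj (dq j A) ** dq j A))"
proof -
  let ?H = "\<Sum>j\<in>UNIV. adj (dq j A) ** dq j A" and ?X = "A - mat (trace A / 2 ^ CARD('n))"
  have H: "psd ?H" by (intro psd_sum psd_gram)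
  obtain B where B: "\<And>v. norm (B *v v) \<le> norm v" and BX: "inner B ?X = Re (trace (mat_abs ?X))"
    by (rule trace_norm_dual) blast
  \<comment> \<open>Replacing a matrix by its scalar mean is self-adjoint, which moves the mean from
    \<open>A\<close> to \<open>B\<close>.\<close>
  have "inner B (mat (trace A / 2 ^ CARD('n))) = inner (mat (trace B / 2 ^ CARD('n))) A"
    by (subst inner_commute) (simp add: inner_mat_left)
  then have "Re (trace (mat_abs ?X)) \<le> pi * Re (trace (mat_sqrt ?H))"
    using Poincare_dual[OF B psd_mat_sqrt[OF H] mat_sqrt_square[OF H]] by (simp add: inner_diff_right flip: BX)
  then show ?thesis
    unfolding norm1_mat_sqrt[OF H] by (simp add: norm1_def divide_right_mono)
qed

subsection \<open>The second inequality\<close>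

lemma matrix_add_rdistrib: "(A + B) ** C = A ** C + B ** C"
  and matrix_sub_rdistrib: "(A - B) ** C = A ** C - B ** C"
  and matrix_sub_ldistrib: "C ** (A - B) = C ** A - C ** B"
  for A B C :: "complex^'i::finite^'i"
  by (simp_all add: matrix_matrix_mult_def vec_eq_iff algebra_simps sum.distrib sum_subtractf)

lemma sum_matrix_mult: "(\<Sum>i\<in>I. f i) ** B = (\<Sum>i\<in>I. f i ** B)" for f :: "'k \<Rightarrow> complex^'i::finite^'i" and B :: "complex^'i^'i"
  by (induction I rule: infinite_finite_induct) (simp_all add: matrix_add_rdistrib)

lemma matrix_mult_sum: "A ** (\<Sum>i\<in>I. f i) = (\<Sum>i\<in>I. A ** f i)" for f :: "'k \<Rightarrow> complex^'i::finite^'j::finite"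
  by (induction I rule: infinite_finite_induct) (simp_all add: matrix_add_ldistrib)

lemma carre_du_champ_eq:
  "carre_du_champ A = (1 / 2) *\<^sub>R (\<Sum>j\<in>UNIV. adj A ** A - cexp j (adj A) ** A - adj A ** cexp j A + cexp j (adj A ** A))"
proof -
  have "Lop (adj A) ** A + adj A ** Lop A - Lop (adj A ** A)
      = (\<Sum>j\<in>UNIV. dq j (adj A) ** A + adj A ** dq j A - dq j (adj A ** A))"
    by (simp add: Lop_def sum_subtractf sum.distrib sum_matrix_mult matrix_mult_sum)
  also have "\<dots> = (\<Sum>j\<in>UNIV. adj A ** A - cexp j (adj A) ** A - adj A ** cexp j A + cexp j (adj A ** A))"
    by (intro sum.cong refl) (simp add: dq_eq matrix_sub_ldistrib matrix_sub_rdistrib)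
  finally show ?thesis by (simp add: carre_du_champ_def)
qed

text \<open>For each \<open>j\<close>, expanding the square of \<open>A *v v - cexp j A *v v\<close>
  gives the summand of the right-hand side except for the term
  \<open>(norm (cexp j A *v v))\<^sup>2\<close>, which Kadison-Schwarz bounds.\<close>

lemma carre_du_champ_bound:
  "(\<Sum>j\<in>UNIV. (norm (dq j A *v v))\<^sup>2) \<le> 2 * inner v (carre_du_champ A *v v)"
proof -
  have "2 * inner v (carre_du_champ A *v v)
      = (\<Sum>j\<in>UNIV. inner (A *v v) (A *v v) - inner (cexp j A *v v) (A *v v) - inner (A *v v) (cexp j A *v v)
          + inner v (cexp j (adj A ** A) *v v))"
    by (simp add: carre_du_champ_eq scaleR_matrix_vector sum_matrix_vector_mult inner_sum_right cexp_adj
        matrix_vector_mult_add_rdistrib matrix_vector_mult_diff_rdistrib inner_add_right inner_diff_right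
        matrix_vector_mul_assoc[symmetric] inner_adj)
  also have "\<dots> \<ge> (\<Sum>j\<in>UNIV. (norm (dq j A *v v))\<^sup>2)"
  proof (rule sum_mono)
    show "(norm (dq j A *v v))\<^sup>2 \<le> inner (A *v v) (A *v v) - inner (cexp j A *v v) (A *v v)
        - inner (A *v v) (cexp j A *v v) + inner v (cexp j (adj A ** A) *v v)" for j
      using cexp_Kadison_Schwarz[of j A v]
      by (simp add: dq_eq matrix_vector_mult_diff_rdistrib power2_norm_eq_inner inner_diff_left inner_diff_right)
  qed
  finally show ?thesis .
qed

lemma psd_carre_du_champ: "psd (carre_du_champ A)"
proof -
  have "0 \<le> inner v (carre_du_champ A *v v)" for v
    using carre_du_champ_bound[of A v] sum_nonneg[of UNIV "\<lambda>j. (norm (dq j A *v v))\<^sup>2"] by simp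
  moreover have "adj (carre_du_champ A) = carre_du_champ A"
    by (simp add: carre_du_champ_eq adj_scaleR adj_sum adj_add adj_diff adj_mult cexp_adj[symmetric] algebra_simps)
  ultimately show ?thesis by (simp add: psd_iff)
qed

lemma psd_scaleR: "psd A \<Longrightarrow> 0 \<le> r \<Longrightarrow> psd (r *\<^sub>R A)"
  by (simp add: psd_iff adj_scaleR scaleR_matrix_vector)

text \<open>Trace monotonicity is applied to the root of the gradient square and to
  \<open>sqrt 2 *\<^sub>R ?N\<close>, whose square is twice the carre du champ.\<close>

lemma norm1_gradient_le_carre_du_champ:
  fixes A :: "('n::finite) qmat"
  shows "norm1 (mat_sqrt (\<Sum>j\<in>UNIV. adj (dq j A) ** dq j A)) \<le> sqrt 2 * norm1 (mat_sqrt (carre_du_champ A))"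
proof -
  let ?H = "\<Sum>j\<in>UNIV. adj (dq j A) ** dq j A"
  let ?N = "mat_sqrt (carre_du_champ A)"
  have H: "psd ?H" by (intro psd_sum psd_gram)
  note G = psd_carre_du_champ[of A]
  have "Re (trace (mat_sqrt ?H)) \<le> Re (trace (sqrt 2 *\<^sub>R ?N))"
  proof (rule Re_trace_mono)
    show "psd (mat_sqrt ?H)" by (rule psd_mat_sqrt[OF H])
    show "psd (sqrt 2 *\<^sub>R ?N)" by (simp add: psd_scaleR psd_mat_sqrt[OF G])
    fix v
    have "(norm (mat_sqrt ?H *v v))\<^sup>2 = (\<Sum>j\<in>UNIV. (norm (dq j A *v v))\<^sup>2)"
      using psd_mat_sqrt[OF H] hermitian_square_norm[of "mat_sqrt ?H" v]
      by (simp add: psd_iff mat_sqrt_square[OF H] sum_matrix_vector_mult inner_sum_right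
          matrix_vector_mul_assoc[symmetric] inner_adj' power2_norm_eq_inner)
    also have "\<dots> \<le> 2 * inner v (carre_du_champ A *v v)" by (rule carre_du_champ_bound)
    also have "\<dots> = (norm ((sqrt 2 *\<^sub>R ?N) *v v))\<^sup>2"
      using psd_mat_sqrt[OF G] hermitian_square_norm[of ?N v]
      by (simp add: psd_iff mat_sqrt_square[OF G] scaleR_matrix_vector power_mult_distrib)
    finally show "norm (mat_sqrt ?H *v v) \<le> norm ((sqrt 2 *\<^sub>R ?N) *v v)"
      by (rule power2_le_imp_le) simp
  qed
  also have "\<dots> = sqrt 2 * Re (trace ?N)"
    by (simp add: trace_def sum_distrib_left)
  finally show ?thesis
    by (simp add: norm1_mat_sqrt[OF H] norm1_mat_sqrt[OF G] divide_right_mono)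
qed

theorem theorem6p14:
  fixes A :: "('n::finite) qmat"
  shows "norm1 (A - mat (trace A / 2 ^ CARD('n)))
           \<le> pi * norm1 (mat_sqrt (\<Sum>j\<in>UNIV. adj (dq j A) ** dq j A))
       \<and> pi * norm1 (mat_sqrt (\<Sum>j\<in>UNIV. adj (dq j A) ** dq j A))
           \<le> sqrt 2 * pi * norm1 (mat_sqrt (carre_du_champ A))"
proof
  show "norm1 (A - mat (trace A / 2 ^ CARD('n))) \<le> pi * norm1 (mat_sqrt (\<Sum>j\<in>UNIV. adj (dq j A) ** dq j A))"
    by (rule Poincare_norm1)
  show "pi * norm1 (mat_sqrt (\<Sum>j\<in>UNIV. adj (dq j A) ** dq j A))
      \<le> sqrt 2 * pi * norm1 (mat_sqrt (carre_du_champ A))"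
    using mult_left_mono[OF norm1_gradient_le_carre_du_champ[of A] pi_ge_zero] by (simp add: mult_ac)
qed

end
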